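(* Suppose that the conditions (Pos), (Exp), (Abs), (Ell) and (Pro) listed in the context hold. Then there exists a unique $\mathcal{F}_\star$-invariant probability measure $\mathbb{Q}_\star$ on $\Omega_\star=\Omega\times\mathcal{W}^{\mathbb{N}}$ equivalent to $\mathbb{P}_\star$, and the dynamical system $(\Omega_\star,\mathcal{F}_\star,\mathbb{Q}_\star)$ is ergodic. In particular, setting $z_n(\bar\omega,\bar w)=\sum_{k=0}^{n-1}\bar w_k$, $$\lim_{n\to\infty}\frac{z_n}{n}=V\qquad \mathbb{P}_\star\text{-a.s.},\qquad V=\int_{\Omega_\star}\bar w_0\; d\mathbb{Q}_\star(\bar\omega,\bar w)\in\mathbb{R}^d.$$
   Context: Setting. Let $d\ge 1$, let $(A,\mathcal{S})$ be a measurable space and $\mathcal{W}\subset\mathbb{Z}^d$ with $2\le\#\mathcal{W}<\infty$. Let $\Omega=A^{\mathbb{Z}^d}$, with translations $(\tau_z\bar\omega)_w=\bar\omega_{w+z}$ ($z,w\in\mathbb{Z}^d$), and let $\mathbb{P}$ be a translation invariant, ergodic probability measure on $\Omega$. For each $n\ge 0$ and $\bar\omega\in\Omega$ one is given a probability $p(\bar\omega,n,\cdot)$ on $\mathcal{W}^n$ (with $p(\bar\omega,0,\emptyset)=1$), measurable in $\bar\omega$, satisfying $\sum_{w_0,\dots,w_{n-1}}p(\bar\omega,n,w_0\ldots w_{n-1})=1$ and the compatibility $p(\bar\omega,n,w_0\ldots w_{n-1})=\sum_{w\in\mathcal{W}}p(\bar\omega,n+1,w_0\ldots w_{n-1}w)$.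 By Kolmogorov's theorem this defines a probability $\mathbb{P}^{\bar\omega}$ on $\mathcal{W}^{\mathbb{N}}$ whose cylinder $[w_0\ldots w_{n-1}]$ has measure $p(\bar\omega,n,w_0\ldots w_{n-1})$. Let $\mathbb{P}_\star(d\bar\omega,d\bar w)=\mathbb{P}(d\bar\omega)\,\mathbb{P}^{\bar\omega}(d\bar w)$ on $\Omega_\star=\Omega\times\mathcal{W}^{\mathbb{N}}$. Define $\mathcal{F}_\star:\Omega_\star\to\Omega_\star$ by $\mathcal{F}_\star(\bar\omega,\bar w)=(\tau_{\bar w_0}\bar\omega,\tau_\star\bar w)$, where $\tau_\star$ is the unilateral shift on $\mathcal{W}^{\mathbb{N}}$. Write $$\mathbb{P}_{\bar\omega}(\bar w_n\mid\bar w_0\ldots\bar w_{n-1})=\frac{p(\bar\omega,n+1,\bar w_0\ldots\bar w_n)}{p(\bar\omega,n,\bar w_0\ldots\bar w_{n-1})}.$$ Conditions: (Pos) For $\mathbb{P}$-a.e. $\bar\omega$, all $n\ge0$ and all $\bar w\in\mathcal{W}^{\mathbb{N}}$: $p(\bar\omega,n,\bar w_0\ldots\bar w_{n-1})>0$. (Exp) There exist $C_*>0$ and $\nu\in(0,1)$ such that for $\mathbb{P}$-a.e. $\bar\omega$, all $n>m\ge0$ and all $\bar w\in\mathcal{W}^{\mathbb{N}}$: $|\mathbb{P}_{\bar\omega}(\bar w_n\mid\bar w_0\ldots\bar w_{n-1})-\mathbb{P}_{\tau_{z_m}\bar\omega}(\bar w_n\mid\bar w_m\ldots\bar w_{n-1})|\le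 C_*\nu^{n-m}$, where $z_m=\sum_{k=0}^{m-1}\bar w_k$. (Abs) There exists $C_0>0$ such that for $\mathbb{P}$-a.e. $\bar\omega$, all $n\ge0$, $k\ge1$ and $\bar w\in\mathcal{W}^{\mathbb{N}}$: $$C_0^{-1}\le\sum_{(w_1,\ldots,w_k)\in\mathcal{W}^k}\frac{p(\tau_{-(w_1+\ldots+w_k)}\bar\omega,n+k,w_1\ldots w_k\bar w_0\ldots\bar w_{n-1})}{p(\bar\omega,n,\bar w_0\ldots\bar w_{n-1})}\le C_0.$$ (Ell) There exist $\gamma_0>0$ and $n_\star\ge0$ such that for a.e. $\bar\omega$, all $n\ge n_\star$ and all $\bar w\in\mathcal{W}^{\mathbb{N}}$: $\mathbb{P}_{\bar\omega}(\bar w_n\mid\bar w_0\ldots\bar w_{n-1})\ge\gamma_0$. (Pro) The set $G=\{z\in\mathbb{Z}^d: z=w_0+\cdots+w_{n-1},\ n\in\mathbb{N},\ w_i\in\mathcal{W}\}$ is an additive group and $\mathbb{P}$ is ergodic with respect to the action $\{\tau_z\}_{z\in G}$. *)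

theory Defs
  imports "HOL-Probability.Probability"
begin

definition environment_space :: "'a measure \<Rightarrow> ((int ^ 'd) \<Rightarrow> 'a) measure" where
  "environment_space A = (\<Pi>\<^sub>M z\<in>UNIV. A)"

definition path_space :: "(int ^ 'd) set \<Rightarrow> (nat \<Rightarrow> int ^ 'd) measure" where
  "path_space W = (\<Pi>\<^sub>M k\<in>UNIV. count_space W)"

definition translate :: "int ^ 'd \<Rightarrow> ((int ^ 'd) \<Rightarrow> 'a) \<Rightarrow> (int ^ 'd) \<Rightarrow> 'a" where
  "translate z \<omega> = (\<lambda>w. \<omega> (w + z))"

definition words :: "(int ^ 'd) set \<Rightarrow> nat \<Rightarrow> (int ^ 'd) list set" where
  "words W n = {ws. length ws = n \<and> set ws \<subseteq> W}"

text \<open>The word \<open>w\<^sub>m \<dots> w\<^sub>n\<^sub>-\<^sub>1\<close> read off from an infinite path.\<close>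

definition segment :: "(nat \<Rightarrow> 'b) \<Rightarrow> nat \<Rightarrow> nat \<Rightarrow> 'b list" where
  "segment w m n = map w [m..<n]"

definition cylinder :: "(int ^ 'd) set \<Rightarrow> (int ^ 'd) list \<Rightarrow> (nat \<Rightarrow> int ^ 'd) set" where
  "cylinder W ws = {w \<in> space (path_space W). segment w 0 (length ws) = ws}"

text \<open>A measure-preserving family \<open>T\<close> of self-maps of a probability space \<open>M\<close> is ergodic
  if every measurable set that is invariant under all of them is trivial. It is used both for a
  group action (\<open>T\<close> the set of all its transformations) and for a single map (\<open>T\<close> a singleton).\<close>

definition invariant_under :: "'b measure \<Rightarrow> ('b \<Rightarrow> 'b) \<Rightarrow> bool" where
  "invariant_under M f \<longleftrightarrow> f \<in> measurable M M \<and> distr M M f = M"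

definition ergodic :: "'b measure \<Rightarrow> ('b \<Rightarrow> 'b) set \<Rightarrow> bool" where
  "ergodic M T \<longleftrightarrow> (\<forall>f\<in>T. invariant_under M f) \<and>
     (\<forall>E\<in>sets M. (\<forall>f\<in>T. f -` E \<inter> space M = E) \<longrightarrow> measure M E = 0 \<or> measure M E = 1)"

definition equivalent_measures :: "'b measure \<Rightarrow> 'b measure \<Rightarrow> bool" where
  "equivalent_measures M N \<longleftrightarrow> absolutely_continuous M N \<and> absolutely_continuous N M"

text \<open>A family of path probabilities is a function \<open>p\<close> of an environment and a finite word; the
  number \<open>n\<close> of steps in \<open>p(\<omega>, n, w\<^sub>0 \<dots> w\<^sub>n\<^sub>-\<^sub>1)\<close> is the length of the word.\<close>

definition path_probabilities ::
    "'a measure \<Rightarrow> (int ^ 'd) set \<Rightarrow> (((int ^ 'd) \<Rightarrow> 'a) \<Rightarrow> (int ^ 'd) list \<Rightarrow> real) \<Rightarrow> bool" where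
  "path_probabilities A W p \<longleftrightarrow>
     (\<forall>n. \<forall>ws\<in>words W n. (\<lambda>\<omega>. p \<omega> ws) \<in> borel_measurable (environment_space A)) \<and>
     (\<forall>\<omega>\<in>space (environment_space A).
        p \<omega> [] = 1 \<and>
        (\<forall>n. \<forall>ws\<in>words W n. p \<omega> ws \<ge> 0) \<and>
        (\<forall>n. (\<Sum>ws\<in>words W n. p \<omega> ws) = 1) \<and>
        (\<forall>n. \<forall>ws\<in>words W n. p \<omega> ws = (\<Sum>w\<in>W. p \<omega> (ws @ [w]))))"

text \<open>The measure whose existence and uniqueness are given by Kolmogorov's theorem; it is a
  probability measure because the cylinder of the empty word is the whole path space.\<close>

definition quenched_measure ::
    "(int ^ 'd) set \<Rightarrow> (((int ^ 'd) \<Rightarrow> 'a) \<Rightarrow> (int ^ 'd) list \<Rightarrow> real) \<Rightarrow>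
     ((int ^ 'd) \<Rightarrow> 'a) \<Rightarrow> (nat \<Rightarrow> int ^ 'd) measure" where
  "quenched_measure W p \<omega> =
     (THE M. sets M = sets (path_space W) \<and>
        (\<forall>n. \<forall>ws\<in>words W n. emeasure M (cylinder W ws) = ennreal (p \<omega> ws)))"

definition extended_space ::
    "'a measure \<Rightarrow> (int ^ 'd) set \<Rightarrow> (((int ^ 'd) \<Rightarrow> 'a) \<times> (nat \<Rightarrow> int ^ 'd)) measure" where
  "extended_space A W = environment_space A \<Otimes>\<^sub>M path_space W"

text \<open>The measure \<open>P(d\<omega>) P\<^sup>\<omega>(dw)\<close>.\<close>

definition annealed_measure ::
    "'a measure \<Rightarrow> (int ^ 'd) set \<Rightarrow> ((int ^ 'd) \<Rightarrow> 'a) measure \<Rightarrow>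
     (((int ^ 'd) \<Rightarrow> 'a) \<Rightarrow> (int ^ 'd) list \<Rightarrow> real) \<Rightarrow>
     (((int ^ 'd) \<Rightarrow> 'a) \<times> (nat \<Rightarrow> int ^ 'd)) measure" where
  "annealed_measure A W P p =
     P \<bind> (\<lambda>\<omega>. distr (quenched_measure W p \<omega>) (extended_space A W) (\<lambda>w. (\<omega>, w)))"

definition walker_map ::
    "((int ^ 'd) \<Rightarrow> 'a) \<times> (nat \<Rightarrow> int ^ 'd) \<Rightarrow> ((int ^ 'd) \<Rightarrow> 'a) \<times> (nat \<Rightarrow> int ^ 'd)" where
  "walker_map = (\<lambda>(\<omega>, w). (translate (w 0) \<omega>, \<lambda>k. w (Suc k)))"

definition position :: "(nat \<Rightarrow> int ^ 'd) \<Rightarrow> nat \<Rightarrow> int ^ 'd" where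
  "position w n = (\<Sum>k<n. w k)"

definition real_vec :: "int ^ 'd \<Rightarrow> real ^ 'd" where
  "real_vec z = (\<chi> i. real_of_int (z $ i))"

text \<open>\<open>cond_step p \<omega> ws w\<close> is the conditional probability that the word \<open>ws\<close> is followed by
  the letter \<open>w\<close>.\<close>

definition cond_step ::
    "(((int ^ 'd) \<Rightarrow> 'a) \<Rightarrow> (int ^ 'd) list \<Rightarrow> real) \<Rightarrow> ((int ^ 'd) \<Rightarrow> 'a) \<Rightarrow>
     (int ^ 'd) list \<Rightarrow> int ^ 'd \<Rightarrow> real" where
  "cond_step p \<omega> ws w = p \<omega> (ws @ [w]) / p \<omega> ws"

definition cond_Pos ::
    "(int ^ 'd) set \<Rightarrow> ((int ^ 'd) \<Rightarrow> 'a) measure \<Rightarrow>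
     (((int ^ 'd) \<Rightarrow> 'a) \<Rightarrow> (int ^ 'd) list \<Rightarrow> real) \<Rightarrow> bool" where
  "cond_Pos W P p \<longleftrightarrow>
     (AE \<omega> in P. \<forall>n. \<forall>w\<in>space (path_space W). p \<omega> (segment w 0 n) > 0)"

definition cond_Exp ::
    "(int ^ 'd) set \<Rightarrow> ((int ^ 'd) \<Rightarrow> 'a) measure \<Rightarrow>
     (((int ^ 'd) \<Rightarrow> 'a) \<Rightarrow> (int ^ 'd) list \<Rightarrow> real) \<Rightarrow> bool" where
  "cond_Exp W P p \<longleftrightarrow>
     (\<exists>C>0. \<exists>\<nu>. 0 < \<nu> \<and> \<nu> < 1 \<and>
        (AE \<omega> in P. \<forall>n m. m < n \<longrightarrow> (\<forall>w\<in>space (path_space W).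
           \<bar>cond_step p \<omega> (segment w 0 n) (w n)
             - cond_step p (translate (position w m) \<omega>) (segment w m n) (w n)\<bar>
           \<le> C * \<nu> ^ (n - m))))"

definition cond_Abs ::
    "(int ^ 'd) set \<Rightarrow> ((int ^ 'd) \<Rightarrow> 'a) measure \<Rightarrow>
     (((int ^ 'd) \<Rightarrow> 'a) \<Rightarrow> (int ^ 'd) list \<Rightarrow> real) \<Rightarrow> bool" where
  "cond_Abs W P p \<longleftrightarrow>
     (\<exists>C>0. AE \<omega> in P. \<forall>n. \<forall>k\<ge>1. \<forall>w\<in>space (path_space W).
        (let S = (\<Sum>us\<in>words W k.
               p (translate (- sum_list us) \<omega>) (us @ segment w 0 n) / p \<omega> (segment w 0 n))
         in inverse C \<le> S \<and> S \<le> C))"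

definition cond_Ell ::
    "(int ^ 'd) set \<Rightarrow> ((int ^ 'd) \<Rightarrow> 'a) measure \<Rightarrow>
     (((int ^ 'd) \<Rightarrow> 'a) \<Rightarrow> (int ^ 'd) list \<Rightarrow> real) \<Rightarrow> bool" where
  "cond_Ell W P p \<longleftrightarrow>
     (\<exists>\<gamma>>0. \<exists>N. AE \<omega> in P. \<forall>n\<ge>N. \<forall>w\<in>space (path_space W).
        cond_step p \<omega> (segment w 0 n) (w n) \<ge> \<gamma>)"

definition reachable :: "(int ^ 'd) set \<Rightarrow> (int ^ 'd) set" where
  "reachable W = {z. \<exists>n. \<exists>ws\<in>words W n. z = sum_list ws}"

definition cond_Pro :: "(int ^ 'd) set \<Rightarrow> ((int ^ 'd) \<Rightarrow> 'a) measure \<Rightarrow> bool" where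
  "cond_Pro W P \<longleftrightarrow>
     0 \<in> reachable W \<and>
     (\<forall>x\<in>reachable W. \<forall>y\<in>reachable W. x + y \<in> reachable W) \<and>
     (\<forall>x\<in>reachable W. - x \<in> reachable W) \<and>
     ergodic P (translate ` reachable W)"

definition invariant_equivalent_measure ::
    "'a measure \<Rightarrow> (int ^ 'd) set \<Rightarrow> ((int ^ 'd) \<Rightarrow> 'a) measure \<Rightarrow>
     (((int ^ 'd) \<Rightarrow> 'a) \<Rightarrow> (int ^ 'd) list \<Rightarrow> real) \<Rightarrow>
     (((int ^ 'd) \<Rightarrow> 'a) \<times> (nat \<Rightarrow> int ^ 'd)) measure \<Rightarrow> bool" where
  "invariant_equivalent_measure A W P p Q \<longleftrightarrow>
     prob_space Q \<and> sets Q = sets (extended_space A W) \<and>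
     invariant_under Q walker_map \<and> equivalent_measures Q (annealed_measure A W P p)"

end

theory Submission imports Defs
begin

text \<open>The invariant measure is built from the images of the annealed measure. By (Abs) and the translation
  invariance of \<open>P\<close>, the images of the annealed measure under the iterates of the walker map are
  comparable to it on rectangles, with one constant for all iterates; a comparison on rectangles
  extends to all events by approximation (\<open>domination_from_rectangles\<close>, \<open>iterated_images_equivalent\<close>).
  The upper limit of the densities of these images is then bounded above and away from zero, it is
  mapped above itself by the transfer operator, and since that operator preserves mass it is
  invariant (\<open>ex_equivalent_invariant_measure\<close>).

  Everything else follows from the fact that an event \<open>E\<close> that is invariant under the walker map has
  annealed probability \<open>0\<close> or \<open>1\<close> (\<open>invariant_event_trivial\<close>). Let \<open>\<phi> \<omega>\<close> be the quenched
  probability of \<open>E\<close> in the environment \<open>\<omega>\<close>. By (Exp) and (Ell) the walker after a long time \<open>n\<close>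
  dominates, up to a constant factor \<open>c\<close>, a walker who starts afresh in the environment seen at time
  \<open>n\<close> (\<open>AE_restart\<close>, \<open>restart_inequality\<close>). If \<open>D\<close> is decided at time \<open>n\<close> and approximates \<open>E\<close>, then
  off \<open>D\<close> the event \<open>E\<close> is rare, so \<open>\<phi>\<close> of the environment seen at time \<open>n\<close> has to be small there;
  the same for the complement of \<open>E\<close> shows that it has to be close to \<open>1\<close> on \<open>D\<close>. Since \<open>E\<close> is
  invariant and the images of the annealed measure are comparable to it, \<open>\<phi>\<close> equals the indicator of
  \<open>E\<close> almost surely (\<open>AE_fibre_mass_eq_indicator\<close>). Thus \<open>E\<close> depends on the environment only, and by
  (Pos) it is invariant under all possible steps of the walker, hence trivial by (Pro).

  So every invariant measure equivalent to the annealed one is ergodic. The ergodic theorem for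
  bounded functions (\<open>birkhoff_bounded\<close>), applied to indicators, determines such a measure by
  almost sure limits with respect to the annealed measure, and applied to the first step it gives
  the speed of the walker.\<close>

section \<open>Bounded Birkhoff averages\<close>

definition orbit_sum :: "('b \<Rightarrow> 'b) \<Rightarrow> ('b \<Rightarrow> real) \<Rightarrow> nat \<Rightarrow> 'b \<Rightarrow> real" where
  "orbit_sum T f n x = (\<Sum>k<n. f ((T ^^ k) x))"

text \<open>The maximum of the orbit sums of lengths \<open>1, \<dots>, n + 1\<close>. The recursion exposes the identity
  \<open>M\<^sub>n\<^sub>+\<^sub>1 - M\<^sub>n \<circ> T = g + max 0 (- M\<^sub>n \<circ> T)\<close> on which the ergodic theorem rests.\<close>

primrec max_orbit_sum :: "('b \<Rightarrow> 'b) \<Rightarrow> ('b \<Rightarrow> real) \<Rightarrow> nat \<Rightarrow> 'b \<Rightarrow> real" where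
  "max_orbit_sum T g 0 x = g x"
| "max_orbit_sum T g (Suc n) x = g x + max 0 (max_orbit_sum T g n (T x))"

lemma orbit_sum_Suc: "orbit_sum T f (Suc n) x = f x + orbit_sum T f n (T x)"
  unfolding orbit_sum_def by (simp add: sum.lessThan_Suc_shift funpow_swap1 del: sum.lessThan_Suc)

lemma max_orbit_sum_mono: "max_orbit_sum T g n x \<le> max_orbit_sum T g (Suc n) x"
proof (induction n arbitrary: x)
  case (Suc n)
  from Suc[of "T x"] show ?case by auto
qed simp

lemma incseq_max_orbit_sum: "incseq (\<lambda>n. max_orbit_sum T g n x)"
  by (rule incseq_SucI) (rule max_orbit_sum_mono)

lemma orbit_sum_le_max: "orbit_sum T g (Suc n) x \<le> max_orbit_sum T g n x"
proof (induction n arbitrary: x)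
  case 0
  then show ?case by (simp add: orbit_sum_def)
next
  case (Suc n)
  show ?case using Suc[of "T x"] by (subst orbit_sum_Suc) simp
qed

lemma max_orbit_sum_measurable [measurable]:
  assumes [measurable]: "T \<in> measurable M M" "g \<in> borel_measurable M"
  shows "max_orbit_sum T g n \<in> borel_measurable M"
proof (induction n)
  case (Suc n)
  note [measurable] = Suc
  have "max_orbit_sum T g (Suc n) = (\<lambda>x. g x + max 0 (max_orbit_sum T g n (T x)))" by auto
  then show ?case by simp
qed (simp add: cong: measurable_cong)

lemma abs_max_orbit_sum_le:
  assumes "T \<in> measurable M M" "\<And>x. x \<in> space M \<Longrightarrow> \<bar>g x\<bar> \<le> c" "x \<in> space M"
  shows "\<bar>max_orbit_sum T g n x\<bar> \<le> real (Suc n) * c"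
  using assms(3)
proof (induction n arbitrary: x)
  case 0
  then show ?case using assms(2) by simp
next
  case (Suc n)
  have "T x \<in> space M" using assms(1) Suc.prems by (rule measurable_space)
  from Suc.IH[OF this] assms(2)[OF Suc.prems]
  show ?case by (simp add: algebra_simps)
qed

context prob_space begin

text \<open>The set where the orbit sums are unbounded above is invariant. If it had full measure, then
  \<open>M\<^sub>n\<^sub>+\<^sub>1 - M\<^sub>n \<circ> T\<close> would tend to \<open>g\<close> almost everywhere, while its integral is that of
  \<open>M\<^sub>n\<^sub>+\<^sub>1 - M\<^sub>n\<close>, which is nonnegative.\<close>

lemma ergodic_negative_mean_imp_bounded_sums:
  assumes erg: "ergodic M {T}"
    and [measurable]: "g \<in> borel_measurable M"
    and bound: "\<And>x. x \<in> space M \<Longrightarrow> \<bar>g x\<bar> \<le> c"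
    and neg: "(\<integral>x. g x \<partial>M) < 0"
  shows "AE x in M. \<exists>b. \<forall>n. orbit_sum T g n x \<le> b"
proof -
  have T [measurable]: "T \<in> measurable M M" and inv: "distr M M T = M"
    using erg by (auto simp: ergodic_def invariant_under_def)
  let ?m = "max_orbit_sum T g"
  define E where "E = {x \<in> space M. \<forall>b::nat. \<exists>n. ?m n x > real b}"
  have E [measurable]: "E \<in> sets M" unfolding E_def by measurable
  have "T -` E \<inter> space M = E"
  proof (intro set_eqI iffI)
    fix x assume "x \<in> T -` E \<inter> space M"
    then have x: "x \<in> space M" and u: "\<And>b::nat. \<exists>n. ?m n (T x) > real b" by (auto simp: E_def)
    have "\<exists>n. ?m n x > real b" for b
    proof -
      obtain b' :: nat where "real b' \<ge> real b + \<bar>g x\<bar>" using real_arch_simple by blast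
      moreover obtain n where "?m n (T x) > real b'" using u by blast
      ultimately have "?m (Suc n) x > real b" by simp
      then show ?thesis by blast
    qed
    with x show "x \<in> E" by (simp add: E_def)
  next
    fix x assume "x \<in> E"
    then have x: "x \<in> space M" and u: "\<And>b::nat. \<exists>n. ?m n x > real b" by (auto simp: E_def)
    have "\<exists>n. ?m n (T x) > real b" for b
    proof -
      obtain b' :: nat where b': "real b' \<ge> real b + \<bar>g x\<bar>" using real_arch_simple by blast
      obtain n where "?m n x > real b'" using u by blast
      then have "?m (Suc n) x > real b'" using max_orbit_sum_mono[of T g n x] by linarith
      with b' have "?m n (T x) > real b" by (auto simp: max_def split: if_splits)
      then show ?thesis by blast
    qed
    with x show "x \<in> T -` E \<inter> space M"
      using measurable_space[OF T x] by (simp add: E_def)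
  qed
  with erg E have "measure M E = 0 \<or> measure M E = 1" by (auto simp: ergodic_def)
  moreover have "measure M E \<noteq> 1"
  proof
    assume "measure M E = 1"
    then have "AE x in M. x \<in> E" using prob_eq_1[OF E] by simp
    then have "AE x in distr M M T. x \<in> E" unfolding inv .
    then have AE_TE: "AE x in M. T x \<in> E" by (rule AE_distrD[OF T])
    let ?d = "\<lambda>n x. ?m (Suc n) x - ?m n (T x)"
    have int_m: "integrable M (?m n)" for n
      by (rule integrable_const_bound[where B="real (Suc n) * c"])
        (use abs_max_orbit_sum_le[OF T bound] in auto)
    have int_mT: "integrable M (\<lambda>x. ?m n (T x))"
      and eq_mT: "(\<integral>x. ?m n (T x) \<partial>M) = (\<integral>x. ?m n x \<partial>M)" for n
      using integrable_distr[OF T, of "?m n"] integral_distr[OF T, of "?m n"] int_m[of n] inv by auto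
    have nonneg: "(\<integral>x. ?d n x \<partial>M) \<ge> 0" for n
    proof -
      have "(\<integral>x. ?m n x \<partial>M) \<le> (\<integral>x. ?m (Suc n) x \<partial>M)"
        by (intro integral_mono int_m max_orbit_sum_mono)
      then show ?thesis using int_m[of "Suc n"] int_mT[of n] eq_mT[of n] by (simp del: max_orbit_sum.simps)
    qed
    have lim: "(\<lambda>n. \<integral>x. ?d n x \<partial>M) \<longlonglongrightarrow> (\<integral>x. g x \<partial>M)"
    proof (rule integral_dominated_convergence[where w="\<lambda>_. 2 * c"])
      show "AE x in M. (\<lambda>n. ?d n x) \<longlonglongrightarrow> g x"
        using AE_TE
      proof eventually_elim
        case (elim x)
        then have "\<exists>n. ?m n (T x) > real 0" unfolding E_def by blast
        then obtain N where N: "?m N (T x) > 0" by auto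
        have "?m n (T x) \<ge> 0" if "n \<ge> N" for n
          using incseqD[OF incseq_max_orbit_sum that, of T g "T x"] N by linarith
        then have "eventually (\<lambda>n. g x = ?d n x) sequentially"
          by (intro eventually_sequentiallyI[of N]) (simp add: max_def)
        then show ?case by (rule Lim_transform_eventually[OF tendsto_const])
      qed
      show "AE x in M. norm (?d n x) \<le> 2 * c" for n
      proof (rule AE_I2)
        fix x assume x: "x \<in> space M"
        have Tx: "T x \<in> space M" using T x by (rule measurable_space)
        have "?m n (T x) \<ge> g (T x)"
          using incseqD[OF incseq_max_orbit_sum, of 0 n T g "T x"] by simp
        with bound[OF x] bound[OF Tx] show "norm (?d n x) \<le> 2 * c" by (auto simp: max_def)
      qed
    qed auto
    have "(\<integral>x. g x \<partial>M) \<ge> 0"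
      by (rule LIMSEQ_le_const[OF lim]) (use nonneg in blast)
    with neg show False by simp
  qed
  ultimately have "AE x in M. x \<notin> E" using prob_eq_0[OF E] by simp
  then show ?thesis
    using AE_space
  proof eventually_elim
    case (elim x)
    then obtain b :: nat where b: "\<And>n. ?m n x \<le> real b" by (auto simp: E_def not_less)
    have "orbit_sum T g n x \<le> real b" for n
    proof (cases n)
      case (Suc k)
      then show ?thesis using order_trans[OF orbit_sum_le_max b, of k] by simp
    qed (simp add: orbit_sum_def)
    then show ?case by blast
  qed
qed

lemma orbit_sum_affine: "orbit_sum T (\<lambda>x. a * f x + e) n x = a * orbit_sum T f n x + real n * e"
  by (simp add: orbit_sum_def sum.distrib sum_distrib_left)

text \<open>Apply the preceding lemma to \<open>\<plusminus>(f - \<integral>f) - \<epsilon>\<close> for a sequence of \<open>\<epsilon>\<close> tending to zero.\<close>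

theorem birkhoff_bounded:
  assumes erg: "ergodic M {T}"
    and [measurable]: "f \<in> borel_measurable M"
    and bound: "\<And>x. x \<in> space M \<Longrightarrow> \<bar>f x\<bar> \<le> c"
  shows "AE x in M. (\<lambda>n. orbit_sum T f n x / real n) \<longlonglongrightarrow> (\<integral>x. f x \<partial>M)"
proof -
  let ?a = "\<integral>x. f x \<partial>M"
  have int: "integrable M f"
    by (rule integrable_const_bound[where B=c]) (use bound in auto)
  have one_sided: "AE x in M. \<exists>b. \<forall>n. s * orbit_sum T f n x + real n * (- s * ?a - e) \<le> b"
    if "e > 0" for s e :: real
  proof -
    have "AE x in M. \<exists>b. \<forall>n. orbit_sum T (\<lambda>x. s * f x + (- s * ?a - e)) n x \<le> b"
    proof (rule ergodic_negative_mean_imp_bounded_sums[OF erg])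
      show "(\<integral>x. s * f x + (- s * ?a - e) \<partial>M) < 0"
        using that int by (simp add: prob_space)
      show "\<bar>s * f x + (- s * ?a - e)\<bar> \<le> \<bar>s\<bar> * c + \<bar>- s * ?a - e\<bar>" if "x \<in> space M" for x
        using abs_triangle_ineq[of "s * f x" "- s * ?a - e"] mult_left_mono[OF bound[OF that], of "\<bar>s\<bar>"]
        by (simp add: abs_mult)
    qed simp
    then show ?thesis by (simp only: orbit_sum_affine)
  qed
  have "AE x in M. \<forall>j::nat. (\<exists>b. \<forall>n. 1 * orbit_sum T f n x + real n * (- 1 * ?a - inverse (real (Suc j))) \<le> b)
      \<and> (\<exists>b. \<forall>n. (- 1) * orbit_sum T f n x + real n * (- (- 1) * ?a - inverse (real (Suc j))) \<le> b)"
    unfolding AE_all_countable by (intro allI AE_conjI one_sided) auto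
  then show ?thesis
  proof eventually_elim
    case (elim x)
    show ?case
    proof (rule LIMSEQ_I)
      fix r :: real assume "r > 0"
      then obtain j where j: "inverse (real (Suc j)) < r / 2" using reals_Archimedean[of "r / 2"] by auto
      obtain b1 b2 where
        b1: "\<And>n. orbit_sum T f n x + real n * (- ?a - inverse (real (Suc j))) \<le> b1" and
        b2: "\<And>n. - orbit_sum T f n x + real n * (?a - inverse (real (Suc j))) \<le> b2"
        using elim[rule_format, of j] by auto
      obtain N :: nat where N: "real N > 2 * (\<bar>b1\<bar> + \<bar>b2\<bar>) / r" using reals_Archimedean2 by blast
      have "norm (orbit_sum T f n x / real n - ?a) < r" if "n \<ge> Suc N" for n
      proof -
        have n: "real n > 0" "real n > 2 * (\<bar>b1\<bar> + \<bar>b2\<bar>) / r" using that N by linarith+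
        have q: "(\<bar>b1\<bar> + \<bar>b2\<bar>) < real n * (r / 2)" using n \<open>r > 0\<close> by (simp add: field_simps)
        have "real n * inverse (real (Suc j)) \<le> real n * (r / 2)"
          using j by (intro mult_left_mono) auto
        then have "\<bar>orbit_sum T f n x - real n * ?a\<bar> < real n * r"
          using b1[of n] b2[of n] q by (simp add: algebra_simps abs_less_iff del: of_nat_Suc) linarith
        moreover have "orbit_sum T f n x / real n - ?a = (orbit_sum T f n x - real n * ?a) / real n"
          using n by (simp add: field_simps)
        ultimately show ?thesis using n by (simp add: field_simps)
      qed
      then show "\<exists>no. \<forall>n\<ge>no. norm (orbit_sum T f n x / real n - ?a) < r" by blast
    qed
  qed
qed

end

section \<open>Approximation by a generating algebra\<close>

text \<open>The approximable sets contain the algebra and form a \<open>\<sigma>\<close>-algebra. Two measures are treated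
  at once because one set has to be approximated in both of them when they are compared.\<close>

lemma algebra_approximation:
  assumes alg: "algebra \<Omega> \<A>"
    and M: "finite_measure M" "sets M = sigma_sets \<Omega> \<A>"
    and N: "finite_measure N" "sets N = sigma_sets \<Omega> \<A>"
    and S: "S \<in> sets M" and e: "0 < e"
  shows "\<exists>D\<in>\<A>. measure M (sym_diff S D) < e \<and> measure N (sym_diff S D) < e"
proof -
  interpret algebra \<Omega> \<A> by fact
  interpret M: finite_measure M by fact
  interpret N: finite_measure N by fact
  have inM: "D \<in> sets M" "D \<in> sets N" if "D \<in> \<A>" for D
    using that M(2) N(2) by auto
  have "S \<in> sigma_sets \<Omega> \<A>" using S M(2) by simp
  then show ?thesis using e
  proof (induction arbitrary: e)
    case (Basic a)
    then show ?case by (intro bexI[of _ a]) auto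
  next
    case Empty
    then show ?case by (intro bexI[of _ "{}"]) auto
  next
    case (Compl a)
    from Compl.IH[OF Compl.prems] obtain D where D: "D \<in> \<A>"
      "measure M (sym_diff a D) < e" "measure N (sym_diff a D) < e" by blast
    have "a \<subseteq> \<Omega>" "D \<subseteq> \<Omega>"
      using Compl.hyps sigma_sets_into_sp[OF space_closed] D(1) sets_into_space by auto
    then have "sym_diff (\<Omega> - a) (\<Omega> - D) = sym_diff a D" by auto
    with D show ?case by (intro bexI[of _ "\<Omega> - D"]) auto
  next
    case (Union a)
    have a: "a i \<in> sets M" "a i \<in> sets N" for i using Union.hyps M(2) N(2) by auto
    let ?U = "\<Union>i. a i" and ?u = "\<lambda>n. \<Union>i<n. a i"
    have tail: "\<exists>n0. \<forall>n\<ge>n0. measure L (?U - ?u n) < e / 2"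
      if L: "finite_measure L" and aL: "\<And>i. a i \<in> sets L" for L
    proof -
      interpret L: finite_measure L by fact
      have "(\<lambda>n. measure L (?u n)) \<longlonglongrightarrow> measure L (\<Union>n. ?u n)"
        using aL by (intro L.finite_Lim_measure_incseq incseq_SucI) (auto simp: less_Suc_eq)
      moreover have "(\<Union>n. ?u n) = ?U" by blast
      ultimately obtain n0 where n0: "\<forall>n\<ge>n0. norm (measure L (?u n) - measure L ?U) < e / 2"
        using LIMSEQ_D[of _ "measure L ?U" "e / 2"] Union.prems by (metis half_gt_zero)
      have eq: "measure L (?U - ?u n) = measure L ?U - measure L (?u n)" for n
        using aL by (intro L.finite_measure_Diff) auto
      have "measure L (?U - ?u n) < e / 2" if "n \<ge> n0" for n
        using n0[rule_format, OF that] by (simp add: eq) argo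
      then show ?thesis by blast
    qed
    obtain n1 n2 where n1: "\<forall>n\<ge>n1. measure M (?U - ?u n) < e / 2"
      and n2: "\<forall>n\<ge>n2. measure N (?U - ?u n) < e / 2"
      using tail[OF M(1)] tail[OF N(1)] a by blast
    define n where "n = Suc (max n1 n2)"
    let ?d = "e / (2 * real n)"
    have "real n > 0" by (simp add: n_def)
    then have d: "?d > 0" and nd: "real n * ?d = e / 2" using Union.prems by simp_all
    from Union.IH[OF d] obtain D where D: "\<And>i. D i \<in> \<A>"
      "\<And>i. measure M (sym_diff (a i) (D i)) < ?d" "\<And>i. measure N (sym_diff (a i) (D i)) < ?d"
      by metis
    let ?D = "\<Union>i<n. D i"
    have sub: "sym_diff ?U ?D \<subseteq> (?U - ?u n) \<union> (\<Union>i<n. sym_diff (a i) (D i))" by blast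
    have bound: "measure L (sym_diff ?U ?D) < e"
      if L: "finite_measure L" and aL: "\<And>i. a i \<in> sets L" and DL: "\<And>i. D i \<in> sets L"
        and t: "measure L (?U - ?u n) < e / 2" and s: "\<And>i. measure L (sym_diff (a i) (D i)) < ?d" for L
    proof -
      interpret L: finite_measure L by fact
      have "measure L (sym_diff ?U ?D) \<le> measure L ((?U - ?u n) \<union> (\<Union>i<n. sym_diff (a i) (D i)))"
        using aL DL by (intro L.finite_measure_mono sub) auto
      also have "\<dots> \<le> measure L (?U - ?u n) + measure L (\<Union>i<n. sym_diff (a i) (D i))"
        using aL DL by (intro measure_subadditive) (auto simp: L.emeasure_eq_measure)
      also have "measure L (\<Union>i<n. sym_diff (a i) (D i)) \<le> (\<Sum>i<n. measure L (sym_diff (a i) (D i)))"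
        using aL DL by (intro measure_subadditive_finite) (auto simp: L.emeasure_eq_measure)
      also have "\<dots> \<le> (\<Sum>i<n. ?d)" using s by (intro sum_mono less_imp_le)
      also have "\<dots> = e / 2" using nd by simp
      finally show ?thesis using t by simp
    qed
    have "?D \<in> \<A>" using D(1) by (intro finite_UN) auto
    moreover have "measure M (sym_diff ?U ?D) < e"
      by (rule bound[OF M(1)]) (use a D inM n1 in \<open>auto simp: n_def\<close>)
    moreover have "measure N (sym_diff ?U ?D) < e"
      by (rule bound[OF N(1)]) (use a D inM n2 in \<open>auto simp: n_def\<close>)
    ultimately show ?case by blast
  qed
qed

lemma (in finite_measure) measure_le_sym_diff:
  assumes "S \<in> sets M" "D \<in> sets M"
  shows "measure M S \<le> measure M D + measure M (sym_diff S D)"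
proof -
  have "measure M S \<le> measure M (D \<union> sym_diff S D)"
    using assms by (intro finite_measure_mono) auto
  also have "\<dots> \<le> measure M D + measure M (sym_diff S D)"
    using assms by (intro measure_subadditive) (auto simp: emeasure_eq_measure)
  finally show ?thesis .
qed

lemma domination_from_algebra:
  assumes alg: "algebra \<Omega> \<A>"
    and M: "finite_measure M" "sets M = sigma_sets \<Omega> \<A>"
    and N: "finite_measure N" "sets N = sigma_sets \<Omega> \<A>"
    and c: "0 \<le> c" and le: "\<And>D. D \<in> \<A> \<Longrightarrow> measure M D \<le> c * measure N D"
    and S: "S \<in> sets M"
  shows "measure M S \<le> c * measure N S"
proof (rule field_le_epsilon)
  fix e :: real assume "0 < e"
  define d where "d = e / (1 + c)"
  have d: "0 < d" "d * (1 + c) = e" using \<open>0 < e\<close> c by (simp_all add: d_def)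
  obtain D where D: "D \<in> \<A>" "measure M (sym_diff S D) < d" "measure N (sym_diff S D) < d"
    using algebra_approximation[OF alg M N S d(1)] by blast
  have sets: "D \<in> sets M" "D \<in> sets N" "S \<in> sets N" using D(1) S M(2) N(2) by auto
  have "measure M S \<le> measure M D + d"
    using finite_measure.measure_le_sym_diff[OF M(1) S sets(1)] D(2) by simp
  also have "\<dots> \<le> c * measure N D + d" using le[OF D(1)] by simp
  also have "measure N D \<le> measure N S + d"
    using finite_measure.measure_le_sym_diff[OF N(1) sets(2) sets(3)] D(3) by (simp add: Un_commute)
  then have "c * measure N D + d \<le> c * (measure N S + d) + d" using c by (simp add: mult_left_mono)
  also have "\<dots> = c * measure N S + e" using d(2) by (simp add: algebra_simps)
  finally show "measure M S \<le> c * measure N S + e" .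
qed

section \<open>Invariant measures of quasi-invariant maps\<close>

lemma AE_le_of_nn_integral_le:
  fixes f g :: "'b \<Rightarrow> ennreal"
  assumes [measurable]: "f \<in> borel_measurable M" "g \<in> borel_measurable M"
    and fin: "(\<integral>\<^sup>+x. f x \<partial>M) < \<infinity>"
    and le: "\<And>S. S \<in> sets M \<Longrightarrow> (\<integral>\<^sup>+x. f x * indicator S x \<partial>M) \<le> (\<integral>\<^sup>+x. g x * indicator S x \<partial>M)"
  shows "AE x in M. f x \<le> g x"
proof -
  define S where "S = {x \<in> space M. g x < f x}"
  have S [measurable]: "S \<in> sets M" unfolding S_def by measurable
  have gf: "g x * indicator S x \<le> f x * indicator S x" for x by (auto simp: S_def indicator_def)
  have "(\<integral>\<^sup>+x. f x * indicator S x \<partial>M) \<le> (\<integral>\<^sup>+x. f x \<partial>M)"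
    by (intro nn_integral_mono) (auto simp: indicator_def)
  with fin have finf: "(\<integral>\<^sup>+x. f x * indicator S x \<partial>M) < \<infinity>" by (simp add: le_less_trans)
  have fing: "(\<integral>\<^sup>+x. g x * indicator S x \<partial>M) < \<infinity>"
    using nn_integral_mono[OF gf] finf by (rule le_less_trans)
  have "(\<integral>\<^sup>+x. f x * indicator S x - g x * indicator S x \<partial>M) =
      (\<integral>\<^sup>+x. f x * indicator S x \<partial>M) - (\<integral>\<^sup>+x. g x * indicator S x \<partial>M)"
    using fing gf by (intro nn_integral_diff) auto
  also have "\<dots> = 0" using le[OF S] finf by (simp add: diff_eq_0_iff_ennreal)
  finally have "AE x in M. f x * indicator S x - g x * indicator S x = 0"
    by (subst (asm) nn_integral_0_iff_AE) auto
  then show ?thesis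
    using AE_space
  proof eventually_elim
    case (elim x)
    show ?case
    proof (rule ccontr)
      assume "\<not> f x \<le> g x"
      then have *: "g x < f x" by simp
      then have "x \<in> S" using elim(2) by (simp add: S_def)
      with elim(1) have "f x \<le> g x" by (simp add: diff_eq_0_iff_ennreal)
      with * show False by (simp add: leD)
    qed
  qed
qed

text \<open>Let \<open>h\<^sub>k\<close> be the density of the \<open>k\<close>-th image of \<open>M\<close>. The transfer operator maps \<open>h\<^sub>k\<close> to
  \<open>h\<^sub>k\<^sub>+\<^sub>1\<close> and is monotone, so it maps \<open>H\<^sub>n = sup\<^sub>k\<^sub>\<ge>\<^sub>n h\<^sub>k\<close> above \<open>H\<^sub>n\<^sub>+\<^sub>1\<close> and, in the limit, it maps
  \<open>limsup h\<^sub>k\<close> above itself. As the operator preserves the total mass, \<open>limsup h\<^sub>k\<close> is an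
  invariant density.\<close>

theorem (in prob_space) ex_equivalent_invariant_measure:
  assumes T [measurable]: "T \<in> measurable M M"
    and c: "0 < c"
    and lower: "\<And>k S. S \<in> sets M \<Longrightarrow> c * measure M S \<le> measure M ((T ^^ k) -` S \<inter> space M)"
    and upper: "\<And>k S. S \<in> sets M \<Longrightarrow> measure M ((T ^^ k) -` S \<inter> space M) \<le> C * measure M S"
  shows "\<exists>Q. prob_space Q \<and> sets Q = sets M \<and> invariant_under Q T \<and> equivalent_measures Q M"
proof -
  define N where "N k = distr M M (T ^^ k)" for k
  have Tk [measurable]: "T ^^ k \<in> measurable M M" for k by (induction k) simp_all
  have N_emeasure: "emeasure (N k) S = emeasure M ((T ^^ k) -` S \<inter> space M)" if "S \<in> sets M" for k S
    using that by (simp add: N_def emeasure_distr)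
  have C: "0 \<le> C" using upper[OF sets.top, of 0] by (simp add: prob_space)
  have N_upper: "emeasure (N k) S \<le> ennreal C * emeasure M S" if "S \<in> sets M" for k S
    using upper[OF that, of k] that C
    by (simp add: N_emeasure emeasure_eq_measure ennreal_mult[symmetric])
  have N_lower: "ennreal c * emeasure M S \<le> emeasure (N k) S" if "S \<in> sets M" for k S
    using lower[OF that, of k] that c
    by (simp add: N_emeasure emeasure_eq_measure ennreal_mult[symmetric])
  define h where "h k = RN_deriv M (N k)" for k
  have h [measurable]: "h k \<in> borel_measurable M" for k by (simp add: h_def)
  have "absolutely_continuous M (N k)" for k
    unfolding absolutely_continuous_def
  proof
    fix S assume "S \<in> null_sets M"
    then have S: "S \<in> sets M" "emeasure M S = 0" by auto
    with N_upper[OF S(1), of k] show "S \<in> null_sets (N k)" by (simp add: null_sets_def) (simp add: N_def)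
  qed
  then have dens: "density M (h k) = N k" for k
    unfolding h_def by (intro density_RN_deriv) (simp_all add: N_def)
  have h_int: "(\<integral>\<^sup>+x. h k x * indicator S x \<partial>M) = emeasure (N k) S" if "S \<in> sets M" for k S
    using that by (simp add: dens[symmetric] emeasure_density)
  have h_fin: "(\<integral>\<^sup>+x. h k x \<partial>M) < \<infinity>" for k
  proof -
    have "(\<integral>\<^sup>+x. h k x \<partial>M) = (\<integral>\<^sup>+x. h k x * indicator (space M) x \<partial>M)"
      by (intro nn_integral_cong) simp
    also have "\<dots> = emeasure (N k) (space M)" by (intro h_int) simp
    also have "\<dots> < \<infinity>" by (subst N_emeasure) (simp_all add: emeasure_eq_measure)
    finally show ?thesis .
  qed
  have h_le: "AE x in M. h k x \<le> ennreal C" for k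
  proof (rule AE_le_of_nn_integral_le[OF _ _ h_fin])
    fix S assume "S \<in> sets M"
    then show "(\<integral>\<^sup>+x. h k x * indicator S x \<partial>M) \<le> (\<integral>\<^sup>+x. ennreal C * indicator S x \<partial>M)"
      using N_upper[of S k] by (simp add: h_int nn_integral_cmult)
  qed simp_all
  define H where "H n x = (SUP k\<in>{n..}. h k x)" for n x
  have H [measurable]: "H n \<in> borel_measurable M" for n unfolding H_def by measurable
  have "decseq H"
    by (intro decseq_SucI le_funI) (auto simp: H_def intro!: SUP_subset_mono)
  then have H_ind: "decseq (\<lambda>n x. H n x * indicator S x)" for S
    by (intro decseq_SucI le_funI mult_right_mono) (auto dest: decseq_SucD le_funD)
  have H_le: "AE x in M. H n x \<le> ennreal C" for n
  proof -
    have "AE x in M. \<forall>k. h k x \<le> ennreal C" using h_le by (simp add: AE_all_countable)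
    then show ?thesis by eventually_elim (auto simp: H_def intro!: SUP_least)
  qed
  define \<nu> where "\<nu> n = density M (H n)" for n
  have \<nu>_upper: "emeasure (\<nu> n) S \<le> ennreal C * emeasure M S" if [measurable]: "S \<in> sets M" for n S
  proof -
    have "emeasure (\<nu> n) S = (\<integral>\<^sup>+x. H n x * indicator S x \<partial>M)" by (simp add: \<nu>_def emeasure_density)
    also have "\<dots> \<le> (\<integral>\<^sup>+x. ennreal C * indicator S x \<partial>M)"
      using H_le[of n] by (intro nn_integral_mono_AE) (auto intro!: mult_right_mono)
    finally show ?thesis by (simp add: nn_integral_cmult)
  qed
  have \<nu>_ge: "emeasure (N k) S \<le> emeasure (\<nu> n) S" if [measurable]: "S \<in> sets M" and "n \<le> k" for n k S
  proof -
    have "(\<integral>\<^sup>+x. h k x * indicator S x \<partial>M) \<le> (\<integral>\<^sup>+x. H n x * indicator S x \<partial>M)"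
      using \<open>n \<le> k\<close> by (intro nn_integral_mono mult_right_mono) (auto simp: H_def intro!: SUP_upper)
    then show ?thesis by (simp add: h_int \<nu>_def emeasure_density)
  qed
  define R where "R = density M (\<lambda>x. INF n. H n x)"
  have R_INF: "emeasure R S = (INF n. emeasure (\<nu> n) S)" if [measurable]: "S \<in> sets M" for S
  proof -
    have "emeasure R S = (\<integral>\<^sup>+x. (INF n. H n x) * indicator S x \<partial>M)"
      unfolding R_def by (subst emeasure_density) simp_all
    also have "\<dots> = (\<integral>\<^sup>+x. (INF n. H n x * indicator S x) \<partial>M)"
      by (intro nn_integral_cong) (auto simp: indicator_def)
    also have "\<dots> = (INF n. \<integral>\<^sup>+x. H n x * indicator S x \<partial>M)"
    proof (rule nn_integral_monotone_convergence_INF_decseq[OF H_ind, where i=0])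
      have "(\<integral>\<^sup>+x. H 0 x * indicator S x \<partial>M) \<le> ennreal C * emeasure M S"
        using \<nu>_upper[of S 0] by (simp add: \<nu>_def emeasure_density)
      also have "\<dots> < \<infinity>" by (simp add: emeasure_eq_measure ennreal_mult_less_top)
      finally show "(\<integral>\<^sup>+x. H 0 x * indicator S x \<partial>M) < \<infinity>" .
    qed simp
    finally show ?thesis by (simp add: \<nu>_def emeasure_density)
  qed
  have step: "emeasure (\<nu> (Suc n)) S \<le> emeasure (\<nu> n) (T -` S \<inter> space M)"
    if S [measurable]: "S \<in> sets M" for n S
  proof -
    define D where "D = distr (\<nu> n) M T"
    have T\<nu> [measurable]: "T \<in> measurable (\<nu> n) M" by (simp add: \<nu>_def)
    have D_emeasure: "emeasure D S = emeasure (\<nu> n) (T -` S \<inter> space M)" if "S \<in> sets M" for S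
      using that by (simp add: D_def emeasure_distr) (simp add: \<nu>_def)
    have "absolutely_continuous M D"
      unfolding absolutely_continuous_def
    proof
      fix S assume "S \<in> null_sets M"
      then have S: "S \<in> sets M" "emeasure M S = 0" by auto
      have "emeasure M (T -` S \<inter> space M) = 0"
        using N_upper[OF S(1), of 1] S by (simp add: N_emeasure)
      then have "emeasure D S = 0"
        using \<nu>_upper[of "T -` S \<inter> space M" n] S(1) by (simp add: D_emeasure)
      with S show "S \<in> null_sets D" by (simp add: null_sets_def D_def)
    qed
    then have G: "density M (RN_deriv M D) = D"
      by (intro density_RN_deriv) (simp_all add: D_def)
    let ?G = "RN_deriv M D"
    have "AE x in M. h (Suc k) x \<le> ?G x" if "n \<le> k" for k
    proof (rule AE_le_of_nn_integral_le[OF _ _ h_fin])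
      fix S assume S [measurable]: "S \<in> sets M"
      have TS: "T -` S \<inter> space M \<in> sets M" by simp
      have "(\<integral>\<^sup>+x. h (Suc k) x * indicator S x \<partial>M) = emeasure M ((T ^^ Suc k) -` S \<inter> space M)"
        by (simp only: h_int[OF S] N_emeasure[OF S])
      also have "(T ^^ Suc k) -` S \<inter> space M = (T ^^ k) -` (T -` S \<inter> space M) \<inter> space M"
        using measurable_space[OF Tk] by auto
      also have "emeasure M \<dots> \<le> emeasure (\<nu> n) (T -` S \<inter> space M)"
        using \<nu>_ge[OF TS that] by (simp add: N_emeasure[OF TS])
      also have "\<dots> = (\<integral>\<^sup>+x. ?G x * indicator S x \<partial>M)"
        by (subst D_emeasure[OF S, symmetric], subst G[symmetric]) (simp add: emeasure_density)
      finally show "(\<integral>\<^sup>+x. h (Suc k) x * indicator S x \<partial>M) \<le> (\<integral>\<^sup>+x. ?G x * indicator S x \<partial>M)" .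
    qed simp_all
    then have "AE x in M. \<forall>k\<in>{n..}. h (Suc k) x \<le> ?G x" by (simp add: AE_ball_countable)
    then have "AE x in M. H (Suc n) x \<le> ?G x"
    proof eventually_elim
      case (elim x)
      have "h k x \<le> ?G x" if "Suc n \<le> k" for k
        using elim[THEN bspec, of "k - 1"] that by (cases k) auto
      then show ?case by (auto simp: H_def intro!: SUP_least)
    qed
    then have "(\<integral>\<^sup>+x. H (Suc n) x * indicator S x \<partial>M) \<le> (\<integral>\<^sup>+x. ?G x * indicator S x \<partial>M)"
      by (intro nn_integral_mono_AE) (auto intro!: mult_right_mono)
    also have "\<dots> = emeasure D S"
      by (subst (2) G[symmetric]) (simp add: emeasure_density)
    finally show ?thesis by (simp add: \<nu>_def emeasure_density D_emeasure)
  qed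
  have R_sets [simp]: "sets R = sets M" "space R = space M" by (simp_all add: R_def)
  have sub: "emeasure R S \<le> emeasure R (T -` S \<inter> space M)" if "S \<in> sets M" for S
  proof -
    have "emeasure R S \<le> emeasure (\<nu> n) (T -` S \<inter> space M)" for n
      using that step[OF that, of n] by (auto simp: R_INF intro: INF_lower2[of "Suc n"])
    then show ?thesis using that by (auto simp: R_INF[of "T -` S \<inter> space M"] intro!: INF_greatest)
  qed
  have R_upper: "emeasure R S \<le> ennreal C * emeasure M S" if "S \<in> sets M" for S
    using \<nu>_upper[OF that, of 0] by (auto simp: R_INF[OF that] intro: INF_lower2[of 0])
  have R_lower: "ennreal c * emeasure M S \<le> emeasure R S" if "S \<in> sets M" for S
    using N_lower[OF that] \<nu>_ge[OF that order_refl]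
    by (auto simp: R_INF[OF that] intro!: INF_greatest intro: order_trans)
  have R_fin: "emeasure R S < \<infinity>" if "S \<in> sets M" for S
    using R_upper[OF that] by (rule le_less_trans) (simp add: emeasure_eq_measure ennreal_mult_less_top)
  interpret R: finite_measure R by (rule finite_measureI) (use R_fin[of "space M"] in auto)
  have R_inv: "emeasure R (T -` S \<inter> space M) = emeasure R S" if S [measurable]: "S \<in> sets M" for S
  proof -
    have eq: "T -` (space M - S) \<inter> space M = space M - (T -` S \<inter> space M)"
      using measurable_space[OF T] by auto
    have "measure R (space M - S) \<le> measure R (space M - (T -` S \<inter> space M))"
      using sub[of "space M - S"] by (simp add: eq R.emeasure_eq_measure)
    then have "measure R (T -` S \<inter> space M) \<le> measure R S"
      using R.finite_measure_compl[of S] R.finite_measure_compl[of "T -` S \<inter> space M"] by simp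
    moreover have "measure R S \<le> measure R (T -` S \<inter> space M)"
      using sub[OF S] by (simp add: R.emeasure_eq_measure)
    ultimately show ?thesis by (simp add: R.emeasure_eq_measure)
  qed
  let ?a = "emeasure R (space M)"
  have "ennreal c * 1 \<le> ?a" using R_lower[of "space M"] by (simp add: emeasure_space_1)
  then have a0: "?a \<noteq> 0" using c by (auto simp: ennreal_eq_0_iff)
  have a1: "?a \<noteq> \<infinity>" using R_fin[of "space M"] by simp
  define Q where "Q = scale_measure (inverse ?a) R"
  have Q_sets: "sets Q = sets M" and Q_space: "space Q = space M"
    by (simp_all add: Q_def space_scale_measure)
  have Q_emeasure: "emeasure Q S = inverse ?a * emeasure R S" for S by (simp add: Q_def)
  have TQ: "T \<in> measurable Q Q" using T by (simp add: measurable_cong_sets[OF Q_sets Q_sets])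
  have "prob_space Q"
    by (rule prob_spaceI)
      (use a0 R_fin[of "space M"] in
        \<open>simp add: Q_space Q_emeasure mult.commute divide_ennreal_def[symmetric] ennreal_divide_self\<close>)
  moreover have "invariant_under Q T"
    unfolding invariant_under_def
  proof
    show "distr Q Q T = Q"
    proof (rule measure_eqI)
      fix S assume "S \<in> sets (distr Q Q T)"
      then have S: "S \<in> sets Q" by simp
      then show "emeasure (distr Q Q T) S = emeasure Q S"
        using R_inv[of S] by (simp add: emeasure_distr[OF TQ S] Q_emeasure Q_space Q_sets)
    qed simp
  qed (rule TQ)
  moreover have "emeasure Q S = 0 \<longleftrightarrow> emeasure M S = 0" if "S \<in> sets M" for S
  proof -
    have "emeasure Q S = 0 \<longleftrightarrow> emeasure R S = 0" using a1 by (auto simp: Q_emeasure)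
    also have "\<dots> \<longleftrightarrow> emeasure M S = 0"
      using R_upper[OF that] R_lower[OF that] c by (auto simp: ennreal_eq_0_iff)
    finally show ?thesis .
  qed
  then have "equivalent_measures Q M"
    by (auto simp: equivalent_measures_def absolutely_continuous_def null_sets_def Q_sets)
  ultimately show ?thesis using Q_sets by blast
qed

section \<open>Words, cylinders and sets with finite horizon\<close>

lemma in_space_path_space: "w \<in> space (path_space W) \<longleftrightarrow> (\<forall>k. w k \<in> W)"
  by (auto simp: path_space_def space_PiM PiE_iff)

lemma length_segment [simp]: "length (segment w m n) = n - m"
  by (simp add: segment_def)

lemma nth_segment [simp]: "i < n - m \<Longrightarrow> segment w m n ! i = w (m + i)"
  by (simp add: segment_def)

lemma segment_empty [simp]: "segment w n n = []"
  by (simp add: segment_def)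

lemma segment_Suc: "segment w 0 (Suc n) = segment w 0 n @ [w n]"
  by (simp add: segment_def)

lemma segment_add: "segment w 0 (m + n) = segment w 0 m @ segment (\<lambda>k. w (m + k)) 0 n"
  by (rule nth_equalityI) (auto simp: nth_append)

lemma segment_shift: "segment w m (m + n) = segment (\<lambda>k. w (m + k)) 0 n"
  by (rule nth_equalityI) auto

lemma position_eq_sum_list: "position w n = sum_list (segment w 0 n)"
  by (simp add: position_def segment_def sum_list_sum_nth atLeast0LessThan)

lemma finite_words: "finite W \<Longrightarrow> finite (words W n)"
  using finite_lists_length_eq[of W n] by (simp add: words_def conj_commute)

lemma segment_in_words: "w \<in> space (path_space W) \<Longrightarrow> segment w m n \<in> words W (n - m)"
  by (auto simp: words_def segment_def in_space_path_space)

lemma initial_segment_in_words: "w \<in> space (path_space W) \<Longrightarrow> segment w 0 n \<in> words W n"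
  using segment_in_words[of w W 0 n] by simp

lemma append_in_words: "u \<in> words W m \<Longrightarrow> v \<in> words W n \<Longrightarrow> u @ v \<in> words W (m + n)"
  by (auto simp: words_def)

lemma snoc_in_words: "u \<in> words W n \<Longrightarrow> a \<in> W \<Longrightarrow> u @ [a] \<in> words W (Suc n)"
  by (auto simp: words_def)

lemma words_0 [simp]: "words W 0 = {[]}"
  by (auto simp: words_def)

lemma ex_path_through:
  assumes "u \<in> words W n" "W \<noteq> {}"
  obtains w where "w \<in> space (path_space W)" "segment w 0 n = u"
proof -
  obtain a where a: "a \<in> W" using assms by blast
  let ?w = "\<lambda>k. if k < n then u ! k else a"
  have "u ! k \<in> W" if "k < n" for k
    using assms(1) that nth_mem[of k u] by (auto simp: words_def)
  then have "?w \<in> space (path_space W)"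
    using a by (simp add: in_space_path_space)
  moreover have "segment ?w 0 n = u"
    using assms by (intro nth_equalityI) (auto simp: words_def)
  ultimately show ?thesis by (rule that)
qed

lemma in_cylinder:
  assumes "u \<in> words W n"
  shows "w \<in> cylinder W u \<longleftrightarrow> w \<in> space (path_space W) \<and> segment w 0 n = u"
  using assms by (auto simp: cylinder_def words_def)

lemma cylinder_Nil [simp]: "cylinder W [] = space (path_space W)"
  by (auto simp: cylinder_def)

lemma coordinate_measurable [measurable]:
  "(\<lambda>w. w k) \<in> measurable (path_space W) (count_space W)"
  unfolding path_space_def by (rule measurable_component_singleton) simp

lemma segment_measurable [measurable]:
  assumes "finite W"
  shows "(\<lambda>w. segment w 0 n) \<in> measurable (path_space W) (count_space (words W n))"
proof (subst measurable_count_space_eq2[OF finite_words[OF assms]], intro conjI ballI)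
  fix u assume u: "u \<in> words W n"
  have "(\<lambda>w. segment w 0 n) -` {u} \<inter> space (path_space W) =
      {w \<in> space (path_space W). \<forall>i<n. w i \<in> {u ! i}}"
    using u by (auto simp: words_def list_eq_iff_nth_eq)
  also have "\<dots> \<in> sets (path_space W)"
    using u by measurable (auto simp: words_def)
  finally show "(\<lambda>w. segment w 0 n) -` {u} \<inter> space (path_space W) \<in> sets (path_space W)" .
qed (use segment_in_words[of _ W 0 n] in auto)

lemma sets_cylinder [measurable]:
  assumes "finite W" "u \<in> words W n"
  shows "cylinder W u \<in> sets (path_space W)"
proof -
  have "cylinder W u = (\<lambda>w. segment w 0 n) -` {u} \<inter> space (path_space W)"
    using in_cylinder[OF assms(2)] by auto
  then show ?thesis using measurable_sets[OF segment_measurable[OF assms(1)], of "{u}" n] assms(2) by simp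
qed

definition cylinders :: "(int ^ 'd) set \<Rightarrow> (nat \<Rightarrow> int ^ 'd) set set" where
  "cylinders W = insert {} (\<Union>n. cylinder W ` words W n)"

lemma Int_stable_cylinders: "Int_stable (cylinders W)"
proof -
  have nested: "cylinder W u \<inter> cylinder W v \<in> cylinders W"
    if u: "u \<in> words W m" and v: "v \<in> words W n" and "m \<le> n" for u v m n
  proof -
    have "segment w 0 m = take m v" if "segment w 0 n = v" for w
      using that \<open>m \<le> n\<close> by (auto simp: segment_def take_map)
    then have "w \<in> cylinder W u \<inter> cylinder W v \<longleftrightarrow> w \<in> (if u = take m v then cylinder W v else {})" for w
      unfolding Int_iff in_cylinder[OF u] by (auto simp: in_cylinder[OF v])
    then have "cylinder W u \<inter> cylinder W v = (if u = take m v then cylinder W v else {})" by blast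
    then show ?thesis using v by (auto simp: cylinders_def)
  qed
  show ?thesis
  proof (rule Int_stableI)
    fix a b assume ab: "a \<in> cylinders W" "b \<in> cylinders W"
    show "a \<inter> b \<in> cylinders W"
    proof (cases "a = {} \<or> b = {}")
      case True
      then show ?thesis by (auto simp: cylinders_def)
    next
      case False
      then obtain u m v n where "u \<in> words W m" "v \<in> words W n" "a = cylinder W u" "b = cylinder W v"
        using ab by (auto simp: cylinders_def)
      then show ?thesis
        using nested[of u m v n] nested[of v n u m] by (cases "m \<le> n") (simp_all add: Int_commute)
    qed
  qed
qed

lemma cylinders_subset: "cylinders W \<subseteq> Pow (space (path_space W))"
  by (auto simp: cylinders_def cylinder_def)

lemma measurable_into_path_space:
  assumes "\<And>k. (\<lambda>x. f x k) \<in> measurable N (count_space W)"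
  shows "f \<in> measurable N (path_space W)"
  unfolding path_space_def
  by (rule measurable_PiM_single'[where f="\<lambda>k x. f x k"])
    (use assms measurable_space[OF assms] in auto)

lemma sets_path_space:
  assumes W: "finite W"
  shows "sets (path_space W) = sigma_sets (space (path_space W)) (cylinders W)"
proof
  define N where "N = sigma (space (path_space W)) (cylinders W)"
  have N: "space N = space (path_space W)" "sets N = sigma_sets (space (path_space W)) (cylinders W)"
    using cylinders_subset[of W] by (simp_all add: N_def)
  show "sigma_sets (space (path_space W)) (cylinders W) \<subseteq> sets (path_space W)"
    using sets_cylinder[OF W] by (intro sets.sigma_sets_subset) (auto simp: cylinders_def)
  have coord: "(\<lambda>w. w k) \<in> measurable N (count_space W)" for k
  proof (subst measurable_count_space_eq2[OF W], intro conjI ballI)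
    fix a assume a: "a \<in> W"
    have "w \<in> cylinder W (v @ [a]) \<longleftrightarrow> w \<in> space (path_space W) \<and> segment w 0 k = v \<and> w k = a"
      if "v \<in> words W k" for v w
      using in_cylinder[OF snoc_in_words[OF that a]] by (auto simp: segment_Suc)
    then have "(\<lambda>w. w k) -` {a} \<inter> space N = (\<Union>v\<in>words W k. cylinder W (v @ [a]))"
      using initial_segment_in_words[of _ W k] by (auto simp: N)
    also have "\<dots> \<in> sets N"
    proof (intro sets.finite_UN finite_words W)
      fix v assume "v \<in> words W k"
      then have "cylinder W (v @ [a]) \<in> cylinders W"
        using snoc_in_words[OF _ a] by (auto simp: cylinders_def)
      then show "cylinder W (v @ [a]) \<in> sets N" by (simp add: N(2))
    qed
    finally show "(\<lambda>w. w k) -` {a} \<inter> space N \<in> sets N" .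
  qed (auto simp: N in_space_path_space)
  have id: "(\<lambda>w. w) \<in> measurable N (path_space W)"
    by (rule measurable_into_path_space[OF coord])
  show "sets (path_space W) \<subseteq> sigma_sets (space (path_space W)) (cylinders W)"
  proof
    fix S assume S: "S \<in> sets (path_space W)"
    then have "(\<lambda>w. w) -` S \<inter> space N = S" using sets.sets_into_space[OF S] by (auto simp: N)
    with measurable_sets[OF id S] show "S \<in> sigma_sets (space (path_space W)) (cylinders W)"
      by (simp add: N)
  qed
qed

lemma space_extended_space:
  "space (extended_space A W) = space (environment_space A) \<times> space (path_space W)"
  by (simp add: extended_space_def space_pair_measure)

text \<open>An event with horizon \<open>n\<close>: the environment is observed completely, the path up to time \<open>n\<close>.\<close>

definition horizon_set ::
    "'a measure \<Rightarrow> (int ^ 'd) set \<Rightarrow> nat \<Rightarrow> ((int ^ 'd) list \<Rightarrow> ((int ^ 'd) \<Rightarrow> 'a) set) \<Rightarrow>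
     (((int ^ 'd) \<Rightarrow> 'a) \<times> (nat \<Rightarrow> int ^ 'd)) set" where
  "horizon_set A W n B = {x \<in> space (extended_space A W). fst x \<in> B (segment (snd x) 0 n)}"

definition finite_horizon ::
    "'a measure \<Rightarrow> (int ^ 'd) set \<Rightarrow> (((int ^ 'd) \<Rightarrow> 'a) \<times> (nat \<Rightarrow> int ^ 'd)) set set" where
  "finite_horizon A W =
     {horizon_set A W n B | n B. \<forall>u\<in>words W n. B u \<in> sets (environment_space A)}"

lemma horizon_setI:
  "\<forall>u\<in>words W n. B u \<in> sets (environment_space A) \<Longrightarrow> horizon_set A W n B \<in> finite_horizon A W"
  by (auto simp: finite_horizon_def)

lemma horizon_set_eq_UN:
  "horizon_set A W n B =
     (\<Union>u\<in>words W n. (B u \<inter> space (environment_space A)) \<times> cylinder W u)"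
  by (auto simp: horizon_set_def space_extended_space in_cylinder initial_segment_in_words)



lemma horizon_set_extend:
  assumes "m \<le> n"
  shows "horizon_set A W m B = horizon_set A W n (\<lambda>u. B (take m u))"
  using assms by (auto simp: horizon_set_def segment_def take_map)

lemma finite_horizon_at_least:
  assumes "D \<in> finite_horizon A W"
  obtains n B where "N \<le> n" "D = horizon_set A W n B" "\<forall>u\<in>words W n. B u \<in> sets (environment_space A)"
proof -
  obtain m B where D: "D = horizon_set A W m B" "\<forall>u\<in>words W m. B u \<in> sets (environment_space A)"
    using assms by (auto simp: finite_horizon_def)
  have "take m u \<in> words W m" if "u \<in> words W (max m N)" for u
    using that by (auto simp: words_def dest: in_set_takeD)
  with D show ?thesis
    by (intro that[of "max m N" "\<lambda>u. B (take m u)"]) (auto simp: horizon_set_extend[of m "max m N"])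
qed

lemma rectangle_sets:
  assumes "finite W" "u \<in> words W n" "B \<in> sets (environment_space A)"
  shows "B \<times> cylinder W u \<in> sets (extended_space A W)"
  unfolding extended_space_def using sets_cylinder[OF assms(1,2)] assms(3) by (rule pair_measureI[rotated])

lemma sets_finite_horizon:
  assumes "finite W" "D \<in> finite_horizon A W"
  shows "D \<in> sets (extended_space A W)"
proof -
  obtain n B where D: "D = horizon_set A W n B" "\<forall>u\<in>words W n. B u \<in> sets (environment_space A)"
    using assms by (auto simp: finite_horizon_def)
  show ?thesis
    unfolding D horizon_set_eq_UN using D(2)
    by (intro sets.finite_UN finite_words rectangle_sets assms(1)) auto
qed

lemma algebra_finite_horizon:
  "algebra (space (extended_space A W)) (finite_horizon A W)"
proof (rule algebra_iff_Un[THEN iffD2], intro conjI ballI)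
  show "finite_horizon A W \<subseteq> Pow (space (extended_space A W))"
    by (auto simp: finite_horizon_def horizon_set_def)
  have "horizon_set A W 0 (\<lambda>_. {}) = {}" by (auto simp: horizon_set_def)
  then show "{} \<in> finite_horizon A W" by (metis horizon_setI sets.empty_sets)
next
  fix D assume "D \<in> finite_horizon A W"
  then obtain n B where D: "D = horizon_set A W n B" "\<forall>u\<in>words W n. B u \<in> sets (environment_space A)"
    by (auto simp: finite_horizon_def)
  have "space (extended_space A W) - D =
      horizon_set A W n (\<lambda>u. space (environment_space A) - B u)"
    by (auto simp: D horizon_set_def space_extended_space)
  then show "space (extended_space A W) - D \<in> finite_horizon A W"
    using D(2) by (auto intro!: horizon_setI)
next
  fix D D' assume "D \<in> finite_horizon A W" and D': "D' \<in> finite_horizon A W"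
  then obtain m B where D: "D = horizon_set A W m B" "\<forall>u\<in>words W m. B u \<in> sets (environment_space A)"
    by (auto simp: finite_horizon_def)
  obtain n B' where n: "m \<le> n" and D': "D' = horizon_set A W n B'"
    "\<forall>u\<in>words W n. B' u \<in> sets (environment_space A)"
    using finite_horizon_at_least[OF D'] by blast
  have "D \<union> D' = horizon_set A W n (\<lambda>u. B (take m u) \<union> B' u)"
    unfolding D D' horizon_set_extend[OF n, of A W B] by (auto simp: horizon_set_def)
  moreover have "take m u \<in> words W m" if "u \<in> words W n" for u
    using that n by (auto simp: words_def dest: in_set_takeD)
  ultimately show "D \<union> D' \<in> finite_horizon A W"
    using D(2) D'(2) by (auto intro!: horizon_setI)
qed

lemma sets_extended_space:
  fixes A :: "'a measure" and W :: "(int ^ 'd) set"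
  assumes W: "finite W"
  shows "sets (extended_space A W) = sigma_sets (space (extended_space A W)) (finite_horizon A W)"
proof
  let ?X = "extended_space A W"
  define N where "N = sigma (space ?X) (finite_horizon A W)"
  interpret algebra "space ?X" "finite_horizon A W" by (rule algebra_finite_horizon)
  have N: "space N = space ?X" "sets N = sigma_sets (space ?X) (finite_horizon A W)"
    using space_closed by (simp_all add: N_def)
  show "sigma_sets (space ?X) (finite_horizon A W) \<subseteq> sets ?X"
    using sets_finite_horizon[OF W] by (intro sets.sigma_sets_subset) auto
  have fst: "fst \<in> measurable N (environment_space A)"
  proof (rule measurableI)
    fix B :: "((int ^ 'd) \<Rightarrow> 'a) set" assume B: "B \<in> sets (environment_space A)"
    have "fst -` B \<inter> space N = horizon_set A W 0 (\<lambda>_. B)"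
      unfolding N by (auto simp: horizon_set_def)
    also have "\<dots> \<in> finite_horizon A W" using B by (auto intro!: horizon_setI)
    finally show "fst -` B \<inter> space N \<in> sets N" unfolding N(2) by (rule sigma_sets.Basic)
  qed (simp add: N space_extended_space mem_Times_iff)
  have coord: "(\<lambda>x. snd x k) \<in> measurable N (count_space W)" for k
  proof (subst measurable_count_space_eq2[OF W], intro conjI ballI)
    fix a assume a: "a \<in> W"
    have "(\<lambda>x. snd x k) -` {a} \<inter> space N =
        horizon_set A W (Suc k) (\<lambda>u. if u ! k = a then space (environment_space A) else {})"
      unfolding N by (auto simp: horizon_set_def space_extended_space)
    also have "\<dots> \<in> finite_horizon A W" by (auto intro!: horizon_setI)
    finally show "(\<lambda>x. snd x k) -` {a} \<inter> space N \<in> sets N" unfolding N(2) by (rule sigma_sets.Basic)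
  qed (auto simp: N space_extended_space in_space_path_space)
  have snd: "snd \<in> measurable N (path_space W)"
    by (rule measurable_into_path_space[OF coord])
  have id: "(\<lambda>x. x) \<in> measurable N ?X"
    using measurable_Pair[OF fst snd] by (simp add: extended_space_def)
  show "sets ?X \<subseteq> sigma_sets (space ?X) (finite_horizon A W)"
  proof
    fix S assume S: "S \<in> sets ?X"
    then have "(\<lambda>w. w) -` S \<inter> space N = S" using sets.sets_into_space[OF S] by (auto simp: N)
    with measurable_sets[OF id S] show "S \<in> sigma_sets (space ?X) (finite_horizon A W)"
      unfolding N by simp
  qed
qed

lemma measure_horizon_set:
  assumes W: "finite W" and M: "finite_measure M" "sets M = sets (extended_space A W)"
    and B: "\<forall>u\<in>words W n. B u \<in> sets (environment_space A)"
  shows "measure M (horizon_set A W n B) = (\<Sum>u\<in>words W n. measure M (B u \<times> cylinder W u))"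
proof -
  interpret finite_measure M by fact
  have "horizon_set A W n B = (\<Union>u\<in>words W n. B u \<times> cylinder W u)"
    using B sets.sets_into_space unfolding horizon_set_eq_UN by (intro SUP_cong) auto
  moreover have "measure M (\<Union>u\<in>words W n. B u \<times> cylinder W u) =
      (\<Sum>u\<in>words W n. measure M (B u \<times> cylinder W u))"
  proof (rule finite_measure_finite_Union)
    show "disjoint_family_on (\<lambda>u. B u \<times> cylinder W u) (words W n)"
      by (auto simp: disjoint_family_on_def in_cylinder)
    show "(\<lambda>u. B u \<times> cylinder W u) ` words W n \<subseteq> sets M"
      using B W by (auto simp: M(2) intro!: rectangle_sets)
  qed (rule finite_words[OF W])
  ultimately show ?thesis by simp
qed

text \<open>An event with finite horizon is a finite disjoint union of rectangles, and these events form a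
  generating algebra.\<close>

lemma domination_from_rectangles:
  assumes W: "finite W"
    and M: "finite_measure M" "sets M = sets (extended_space A W)"
    and N: "finite_measure N" "sets N = sets (extended_space A W)"
    and c: "0 \<le> c"
    and le: "\<And>n u B. u \<in> words W n \<Longrightarrow> B \<in> sets (environment_space A) \<Longrightarrow>
      measure M (B \<times> cylinder W u) \<le> c * measure N (B \<times> cylinder W u)"
    and S: "S \<in> sets M"
  shows "measure M S \<le> c * measure N S"
proof (rule domination_from_algebra[OF algebra_finite_horizon[of A W] M(1) _ N(1) _ c _ S])
  fix D assume "D \<in> finite_horizon A W"
  then obtain n B where D: "D = horizon_set A W n B" "\<forall>u\<in>words W n. B u \<in> sets (environment_space A)"
    by (auto simp: finite_horizon_def)
  show "measure M D \<le> c * measure N D"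
    unfolding D(1) measure_horizon_set[OF W M D(2)] measure_horizon_set[OF W N D(2)] sum_distrib_left
    using D(2) by (intro sum_mono le) auto
qed (simp_all add: M N sets_extended_space[OF W])

section \<open>Kolmogorov extension for path probabilities\<close>

text \<open>The path is generated letter by letter; the word \<open>u\<close> is followed by \<open>a\<close> with probability
  \<open>q (u a) / q u\<close>, and by a fixed letter if \<open>q u = 0\<close>.\<close>

lemma ex_path_measure:
  fixes q :: "(int ^ 'd) list \<Rightarrow> real"
  assumes W: "finite W" "W \<noteq> {}"
    and q: "q [] = 1" "\<And>n u. u \<in> words W n \<Longrightarrow> 0 \<le> q u"
      "\<And>n u. u \<in> words W n \<Longrightarrow> q u = (\<Sum>a\<in>W. q (u @ [a]))"
  shows "\<exists>M. sets M = sets (path_space W) \<and>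
    (\<forall>n. \<forall>u\<in>words W n. emeasure M (cylinder W u) = ennreal (q u))"
proof -
  obtain a0 where a0: "a0 \<in> W" using W by blast
  define st where "st u a = (if q u = 0 then if a = a0 then 1 else 0 else q (u @ [a]) / q u)" for u a
  define K where "K n x = point_measure W (\<lambda>a. ennreal (st (map x [0..<n]) a))" for n and x :: "nat \<Rightarrow> int ^ 'd"
  let ?M = "\<lambda>_::nat. count_space W"
  have PiM_eq: "PiM {0..<n} ?M = count_space (PiE {0..<n} (\<lambda>_. W))" for n
    using W by (intro count_space_PiM_finite) (auto intro: countable_finite)
  have word: "map x [0..<n] \<in> words W n" if "x \<in> space (PiM {0..<n} ?M)" for x n
    using that by (auto simp: words_def space_PiM PiE_iff)
  have st0: "0 \<le> st u a" if "u \<in> words W n" "a \<in> W" for u a n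
    using q(2)[OF that(1)] q(2)[OF snoc_in_words[OF that]] by (simp add: st_def)
  have st1: "(\<Sum>a\<in>W. st u a) = 1" if "u \<in> words W n" for u n
  proof (cases "q u = 0")
    case True
    then show ?thesis using W(1) a0 by (simp add: st_def sum.delta)
  next
    case False
    then have "(\<Sum>a\<in>W. st u a) = (\<Sum>a\<in>W. q (u @ [a])) / q u"
      by (simp add: st_def sum_divide_distrib)
    with False show ?thesis by (simp add: q(3)[OF that, symmetric])
  qed
  have st_mult: "st u a * q u = q (u @ [a])" if u: "u \<in> words W n" and a: "a \<in> W" for u a n
  proof (cases "q u = 0")
    case True
    then have "(\<Sum>a\<in>W. q (u @ [a])) = 0" using q(3)[OF u] by simp
    then have "q (u @ [a]) = 0"
      using W(1) a q(2)[OF snoc_in_words[OF u]] by (subst (asm) sum_nonneg_eq_0_iff) auto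
    with True show ?thesis by simp
  qed (simp add: st_def)
  have prob_K: "prob_space (K n x)" if x: "x \<in> space (PiM {0..<n} ?M)" for n x
  proof (rule prob_spaceI)
    have "emeasure (K n x) W = (\<Sum>a\<in>W. ennreal (st (map x [0..<n]) a))"
      using W(1) by (simp add: K_def emeasure_point_measure_finite)
    also have "\<dots> = 1"
      using st0[OF word[OF x]] st1[OF word[OF x]] by (subst sum_ennreal) auto
    finally show "emeasure (K n x) (space (K n x)) = 1" by (simp add: K_def space_point_measure)
  qed
  interpret IT: Ionescu_Tulcea K ?M
  proof (rule Ionescu_Tulcea.intro)
    show "K n \<in> measurable (PiM {0..<n} ?M) (subprob_algebra (?M n))" for n
      unfolding PiM_eq measurable_count_space_eq1
      using prob_K[of _ n, THEN prob_space_imp_subprob_space]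
      by (auto simp: PiM_eq space_subprob_algebra K_def sets_point_measure)
  qed (rule prob_K)
  define pt where "pt u = restrict (nth u) {0..<length u}" for u :: "(int ^ 'd) list"
  have pt: "pt u \<in> PiE {0..<n} (\<lambda>_. W)" if "u \<in> words W n" for u n
    using that by (auto simp: pt_def words_def)
  have C: "emeasure (IT.C 0 n (\<lambda>_. undefined)) {pt u} = ennreal (q u)" if "u \<in> words W n" for n u
    using that
  proof (induction n arbitrary: u)
    case 0
    then show ?case by (simp add: pt_def q(1) emeasure_return PiM_empty restrict_def)
  next
    case (Suc n)
    obtain v a where u: "u = v @ [a]" "v \<in> words W n" "a \<in> W"
    proof (cases u rule: rev_cases)
      case (snoc v a)
      with Suc.prems show ?thesis by (intro that) (auto simp: words_def)
    qed (use Suc.prems in \<open>simp add: words_def\<close>)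
    have pt_sets: "{pt u} \<in> sets (PiM {0..<Suc n} ?M)" "{pt v} \<in> sets (PiM {0..<n} ?M)"
      using pt[OF Suc.prems] pt[OF u(2)] unfolding PiM_eq by auto
    have len: "length v = n" using u by (simp add: words_def)
    have und: "(\<lambda>_. undefined) \<in> space (PiM {0..<0::nat} ?M)" by (simp add: space_PiM)
    have "emeasure (IT.eP n x) {pt u} = ennreal (st v a) * indicator {pt v} x"
      if x: "x \<in> space (PiM {0..<n} ?M)" for x
    proof -
      have ext: "x k = undefined" if "\<not> k < n" for k
        using x that by (auto simp: space_PiM PiE_iff extensional_def)
      have "x(n := b) = pt u \<longleftrightarrow> x = pt v \<and> b = a" for b
      proof
        assume eq: "x(n := b) = pt u"
        have "b = a" using fun_cong[OF eq, of n] by (simp add: pt_def u(1) len nth_append)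
        moreover have "x k = pt v k" for k
          using fun_cong[OF eq, of k] ext[of k] by (cases "k < n") (auto simp: pt_def u(1) len nth_append)
        ultimately show "x = pt v \<and> b = a" by blast
      qed (auto simp: pt_def u(1) len nth_append fun_eq_iff less_Suc_eq)
      then have "(\<lambda>b. x(n := b)) -` {pt u} \<inter> W = (if x = pt v then {a} else {})"
        using u(3) by auto
      moreover have "emeasure (IT.eP n x) {pt u} =
          emeasure (K n x) ((\<lambda>b. x(n := b)) -` {pt u} \<inter> space (count_space W))"
        by (rule IT.emeasure_eP[OF x pt_sets(1)])
      moreover have "map (pt v) [0..<n] = v"
        by (rule nth_equalityI) (auto simp: pt_def len)
      ultimately show ?thesis
        using W(1) u(3) by (simp add: K_def emeasure_point_measure_finite)
    qed
    note eP = this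
    have sp: "space (IT.C 0 n (\<lambda>_. undefined)) = space (PiM {0..<n} ?M)"
      and se: "sets (IT.C 0 n (\<lambda>_. undefined)) = sets (PiM {0..<n} ?M)"
      using IT.space_C[OF und, of n] IT.sets_C[OF und, of n] by simp_all
    have "emeasure (IT.C 0 (Suc n) (\<lambda>_. undefined)) {pt u} =
        (\<integral>\<^sup>+x. emeasure (IT.eP n x) {pt u} \<partial>IT.C 0 n (\<lambda>_. undefined))"
      using IT.measurable_eP[of n] IT.non_empty pt_sets(1)
      by (simp, subst emeasure_bind[where N="PiM {0..<Suc n} ?M"])
        (auto simp: sp space_PiM_empty_iff measurable_cong_sets[OF se refl] simp del: IT.non_empty)
    also have "\<dots> = (\<integral>\<^sup>+x. ennreal (st v a) * indicator {pt v} x \<partial>IT.C 0 n (\<lambda>_. undefined))"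
      by (intro nn_integral_cong) (simp add: eP sp)
    also have "\<dots> = ennreal (st v a) * ennreal (q v)"
      using Suc.IH[OF u(2)] pt_sets(2) by (subst nn_integral_cmult_indicator) (auto simp: se)
    also have "\<dots> = ennreal (q u)"
      using st_mult[OF u(2,3)] st0[OF u(2,3)] q(2)[OF u(2)] by (simp add: u(1) ennreal_mult[symmetric])
    finally show ?case .
  qed
  have lim_sets: "sets IT.PF.lim = sets (path_space W)"
    by (simp add: path_space_def)
  have "emeasure IT.PF.lim (cylinder W u) = ennreal (q u)" if u: "u \<in> words W n" for u n
  proof -
    have len: "length u = n" using u by (simp add: words_def)
    have X: "{pt u} \<in> sets (PiM {0..<n} ?M)" using pt[OF u] unfolding PiM_eq by auto
    have "cylinder W u = IT.PF.emb UNIV {0..<n} {pt u}"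
      unfolding prod_emb_def set_eq_iff in_cylinder[OF u]
      by (auto simp: path_space_def space_PiM pt_def len fun_eq_iff restrict_def list_eq_iff_nth_eq)
    then have "emeasure IT.PF.lim (cylinder W u) = emeasure (IT.CI {0..<n}) {pt u}"
      using IT.lim[OF _ X] by simp
    also have "\<dots> = emeasure (IT.C 0 n (\<lambda>_. undefined)) (prod_emb {0..<n} ?M {0..<n} {pt u})"
      by (rule IT.emeasure_CI[OF _ X]) simp
    also have "prod_emb {0..<n} ?M {0..<n} {pt u} = {pt u}"
      by (rule prod_emb_id) (use pt[OF u] in simp)
    finally show ?thesis using C[OF u] by simp
  qed
  with lim_sets show ?thesis by blast
qed

lemma path_measure_unique:
  assumes W: "finite W" and M: "sets M = sets (path_space W)" and N: "sets N = sets (path_space W)"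
    and eq: "\<And>n u. u \<in> words W n \<Longrightarrow> emeasure M (cylinder W u) = emeasure N (cylinder W u)"
    and fin: "emeasure M (space (path_space W)) \<noteq> \<infinity>"
  shows "M = N"
proof (rule measure_eqI_generator_eq[OF Int_stable_cylinders cylinders_subset, where A="\<lambda>_. space (path_space W)"])
  have "cylinder W [] \<in> cylinders W"
    unfolding cylinders_def using words_0 by blast
  then show "range (\<lambda>_. space (path_space W)) \<subseteq> cylinders W" by auto
  show "emeasure M X = emeasure N X" if "X \<in> cylinders W" for X
    using that eq by (auto simp: cylinders_def)
qed (use fin in \<open>simp_all add: M N sets_path_space[OF W]\<close>)

section \<open>Quenched and annealed measures\<close>

lemma emeasure_domination_from_rectangles:
  assumes W: "finite W"
    and M: "finite_measure M" "sets M = sets (extended_space A W)"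
    and N: "finite_measure N" "sets N = sets (extended_space A W)"
    and c: "0 \<le> c"
    and le: "\<And>n u B. u \<in> words W n \<Longrightarrow> B \<in> sets (environment_space A) \<Longrightarrow>
      emeasure M (B \<times> cylinder W u) \<le> ennreal c * emeasure N (B \<times> cylinder W u)"
    and S: "S \<in> sets (extended_space A W)"
  shows "emeasure M S \<le> ennreal c * emeasure N S"
proof -
  interpret M: finite_measure M by fact
  interpret N: finite_measure N by fact
  have "measure M S \<le> c * measure N S"
  proof (rule domination_from_rectangles[OF W M N c])
    show "measure M (B \<times> cylinder W u) \<le> c * measure N (B \<times> cylinder W u)"
      if "u \<in> words W n" "B \<in> sets (environment_space A)" for n u B
      using le[OF that] c by (simp add: M.emeasure_eq_measure N.emeasure_eq_measure ennreal_mult[symmetric])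
  qed (use S M(2) in simp)
  then show ?thesis
    using c by (simp add: M.emeasure_eq_measure N.emeasure_eq_measure ennreal_mult[symmetric])
qed

lemma translate_add: "translate y (translate z \<omega>) = translate (y + z) \<omega>"
  by (simp add: translate_def add.assoc)

lemma translate_0 [simp]: "translate 0 \<omega> = \<omega>"
  by (simp add: translate_def)

lemma translate_measurable [measurable]:
  "translate z \<in> measurable (environment_space A) (environment_space A)"
  unfolding translate_def environment_space_def
  by (rule measurable_PiM_single'[where f="\<lambda>w \<omega>. \<omega> (w + z)"])
    (auto simp: space_PiM PiE_iff intro!: measurable_component_singleton)

lemma walker_map_eq: "walker_map x = (translate (snd x 0) (fst x), \<lambda>k. snd x (Suc k))"
  by (simp add: walker_map_def split_beta)

lemma walker_map_funpow:
  "(walker_map ^^ k) x = (translate (position (snd x) k) (fst x), \<lambda>j. snd x (k + j))"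
proof (induction k)
  case (Suc k)
  then show ?case by (simp add: walker_map_eq translate_add position_def add.commute)
qed (simp add: position_def)

locale random_walk =
  fixes A :: "'a measure"
    and W :: "(int ^ 'd) set"
    and P :: "((int ^ 'd) \<Rightarrow> 'a) measure"
    and p :: "((int ^ 'd) \<Rightarrow> 'a) \<Rightarrow> (int ^ 'd) list \<Rightarrow> real"
  assumes finite_W: "finite W" and W_nonempty: "W \<noteq> {}"
    and prob_P: "prob_space P" and sets_P: "sets P = sets (environment_space A)"
    and invariant_P: "invariant_under P (translate z)"
    and path_prob: "path_probabilities A W p"
begin

abbreviation Env :: "((int ^ 'd) \<Rightarrow> 'a) measure" where "Env \<equiv> environment_space A"
abbreviation "Ext \<equiv> extended_space A W"
abbreviation "Paths \<equiv> path_space W"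
abbreviation "K \<equiv> quenched_measure W p"
abbreviation "Ann \<equiv> annealed_measure A W P p"

sublocale P: prob_space P by (rule prob_P)

lemma space_P: "space P = space Env"
  using sets_P by (rule sets_eq_imp_space_eq)

lemma Env_nonempty: "space Env \<noteq> {}"
  using P.not_empty by (simp add: space_P)

lemma p_measurable: "u \<in> words W n \<Longrightarrow> (\<lambda>\<omega>. p \<omega> u) \<in> borel_measurable Env"
  using path_prob unfolding path_probabilities_def by blast

lemma p_Nil: "\<omega> \<in> space Env \<Longrightarrow> p \<omega> [] = 1"
  and p_nonneg: "\<omega> \<in> space Env \<Longrightarrow> u \<in> words W n \<Longrightarrow> 0 \<le> p \<omega> u"
  and p_snoc: "\<omega> \<in> space Env \<Longrightarrow> u \<in> words W n \<Longrightarrow> p \<omega> u = (\<Sum>a\<in>W. p \<omega> (u @ [a]))"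
  using path_prob unfolding path_probabilities_def by blast+

lemma
  assumes \<omega>: "\<omega> \<in> space Env"
  shows sets_K [simp]: "sets (K \<omega>) = sets Paths"
    and emeasure_K_cylinder: "u \<in> words W n \<Longrightarrow> emeasure (K \<omega>) (cylinder W u) = ennreal (p \<omega> u)"
proof -
  let ?Q = "\<lambda>M. sets M = sets Paths \<and> (\<forall>n. \<forall>u\<in>words W n. emeasure M (cylinder W u) = ennreal (p \<omega> u))"
  obtain M where M: "?Q M"
    using ex_path_measure[OF finite_W W_nonempty, of "p \<omega>"] p_Nil[OF \<omega>] p_nonneg[OF \<omega>] p_snoc[OF \<omega>] by blast
  have "M' = M" if "?Q M'" for M'
  proof (rule path_measure_unique[OF finite_W])
    have "emeasure M' (cylinder W []) = ennreal (p \<omega> [])" using that words_0 by blast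
    then show "emeasure M' (space Paths) \<noteq> \<infinity>" by simp
  qed (use that M in auto)
  with M have "?Q (K \<omega>)" unfolding quenched_measure_def by (rule theI)
  then show "sets (K \<omega>) = sets Paths"
    and "u \<in> words W n \<Longrightarrow> emeasure (K \<omega>) (cylinder W u) = ennreal (p \<omega> u)" by blast+
qed

lemma space_K [simp]: "\<omega> \<in> space Env \<Longrightarrow> space (K \<omega>) = space Paths"
  by (rule sets_eq_imp_space_eq) simp

lemma prob_space_K: "\<omega> \<in> space Env \<Longrightarrow> prob_space (K \<omega>)"
  using emeasure_K_cylinder[of \<omega> "[]" 0] by (intro prob_spaceI) (simp add: p_Nil)

lemma K_measurable: "K \<in> measurable Env (prob_algebra Paths)"
proof (rule measurable_prob_algebra_generated[OF sets_path_space[OF finite_W] Int_stable_cylinders cylinders_subset])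
  fix S assume S: "S \<in> cylinders W"
  show "(\<lambda>\<omega>. emeasure (K \<omega>) S) \<in> borel_measurable Env"
  proof (cases "S = {}")
    case False
    then obtain u n where u: "u \<in> words W n" "S = cylinder W u" using S by (auto simp: cylinders_def)
    have "(\<lambda>\<omega>. ennreal (p \<omega> u)) \<in> borel_measurable Env" using p_measurable[OF u(1)] by simp
    then show ?thesis
      by (rule measurable_cong[THEN iffD1, rotated]) (simp add: u(2) emeasure_K_cylinder[OF _ u(1)])
  qed simp
qed (simp_all add: prob_space_K)

lemma K_measurable_subprob [measurable]: "K \<in> measurable Env (subprob_algebra Paths)"
  using K_measurable by (rule measurable_prob_algebraD)

text \<open>The annealed measure with \<open>R\<close> in place of \<open>P\<close>; below, \<open>R\<close> will be the law of the environment
  seen by the walker at a later time.\<close>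

definition joint :: "((int ^ 'd) \<Rightarrow> 'a) measure \<Rightarrow> (((int ^ 'd) \<Rightarrow> 'a) \<times> (nat \<Rightarrow> int ^ 'd)) measure" where
  "joint R = R \<bind> (\<lambda>\<omega>. distr (K \<omega>) Ext (\<lambda>w. (\<omega>, w)))"

lemma Ann_eq_joint: "Ann = joint P"
  by (simp add: annealed_measure_def joint_def)

lemma Pair_measurable: "\<omega> \<in> space Env \<Longrightarrow> (\<lambda>w. (\<omega>, w)) \<in> measurable Paths Ext"
  unfolding extended_space_def by simp

lemma joint_kernel_measurable:
  "(\<lambda>\<omega>. distr (K \<omega>) Ext (\<lambda>w. (\<omega>, w))) \<in> measurable Env (subprob_algebra Ext)"
  by (rule measurable_distr2[OF _ K_measurable_subprob]) (simp add: extended_space_def)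

definition fibre_mass :: "(((int ^ 'd) \<Rightarrow> 'a) \<times> (nat \<Rightarrow> int ^ 'd)) set \<Rightarrow> ((int ^ 'd) \<Rightarrow> 'a) \<Rightarrow> real" where
  "fibre_mass S \<omega> = measure (K \<omega>) (Pair \<omega> -` S \<inter> space Paths)"

lemma fibre_mass_bounds:
  assumes "\<omega> \<in> space Env"
  shows "0 \<le> fibre_mass S \<omega>" "fibre_mass S \<omega> \<le> 1"
  using prob_space.prob_le_1[OF prob_space_K[OF assms]] by (auto simp: fibre_mass_def)

lemma emeasure_fibre:
  assumes "\<omega> \<in> space Env" "S \<in> sets Ext"
  shows "emeasure (distr (K \<omega>) Ext (\<lambda>w. (\<omega>, w))) S = ennreal (fibre_mass S \<omega>)"
proof -
  interpret K\<omega>: prob_space "K \<omega>" by (rule prob_space_K) fact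
  have "(\<lambda>w. (\<omega>, w)) \<in> measurable (K \<omega>) Ext"
    using Pair_measurable[OF assms(1)] by (simp add: measurable_cong_sets[OF sets_K[OF assms(1)] refl])
  then show ?thesis
    using assms by (simp add: emeasure_distr fibre_mass_def K\<omega>.emeasure_eq_measure)
qed

lemma fibre_mass_measurable [measurable]:
  assumes S: "S \<in> sets Ext"
  shows "fibre_mass S \<in> borel_measurable Env"
proof -
  have "(\<lambda>\<omega>. measure (distr (K \<omega>) Ext (\<lambda>w. (\<omega>, w))) S) \<in> borel_measurable Env"
    by (rule measurable_compose[OF joint_kernel_measurable measurable_measure_subprob_algebra[OF S]])
  then show ?thesis
    by (rule measurable_cong[THEN iffD1, rotated])
      (use emeasure_fibre[OF _ S] fibre_mass_bounds in \<open>simp add: measure_def\<close>)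
qed

context
  fixes R assumes sets_R: "sets R = sets Env"
begin

lemma space_R: "space R = space Env"
  using sets_R by (rule sets_eq_imp_space_eq)

lemma sets_joint [simp]: "sets (joint R) = sets Ext"
  unfolding joint_def using Env_nonempty by (subst sets_bind[where N=Ext]) (auto simp: space_R)

lemma space_joint [simp]: "space (joint R) = space Ext"
  by (rule sets_eq_imp_space_eq) simp

lemma emeasure_joint:
  assumes S: "S \<in> sets Ext"
  shows "emeasure (joint R) S = (\<integral>\<^sup>+\<omega>. ennreal (fibre_mass S \<omega>) \<partial>R)"
proof -
  have "(\<lambda>\<omega>. distr (K \<omega>) Ext (\<lambda>w. (\<omega>, w))) \<in> measurable R (subprob_algebra Ext)"
    using joint_kernel_measurable by (simp add: measurable_cong_sets[OF sets_R refl])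
  then have "emeasure (joint R) S = (\<integral>\<^sup>+\<omega>. emeasure (distr (K \<omega>) Ext (\<lambda>w. (\<omega>, w))) S \<partial>R)"
    unfolding joint_def using Env_nonempty S by (intro emeasure_bind) (auto simp: space_R)
  also have "\<dots> = (\<integral>\<^sup>+\<omega>. ennreal (fibre_mass S \<omega>) \<partial>R)"
    using S by (intro nn_integral_cong) (simp add: space_R emeasure_fibre)
  finally show ?thesis .
qed

lemma emeasure_joint_rectangle:
  assumes u: "u \<in> words W n" and B: "B \<in> sets Env"
  shows "emeasure (joint R) (B \<times> cylinder W u) = (\<integral>\<^sup>+\<omega>. ennreal (p \<omega> u) * indicator B \<omega> \<partial>R)"
proof -
  have "fibre_mass (B \<times> cylinder W u) \<omega> = p \<omega> u * indicator B \<omega>" if \<omega>: "\<omega> \<in> space Env" for \<omega>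
  proof -
    have "Pair \<omega> -` (B \<times> cylinder W u) \<inter> space Paths = (if \<omega> \<in> B then cylinder W u else {})"
      by (auto simp: in_cylinder[OF u])
    then show ?thesis
      using emeasure_K_cylinder[OF \<omega> u] p_nonneg[OF \<omega> u] by (simp add: fibre_mass_def measure_def)
  qed
  then show ?thesis
    using B u by (subst emeasure_joint)
      (auto intro!: nn_integral_cong rectangle_sets finite_W simp: space_R indicator_def)
qed

lemma finite_joint:
  assumes "finite_measure R"
  shows "finite_measure (joint R)"
proof (rule finite_measureI)
  interpret R: finite_measure R by fact
  have "emeasure (joint R) (space (joint R)) = (\<integral>\<^sup>+\<omega>. ennreal (fibre_mass (space Ext) \<omega>) \<partial>R)"
    by (simp add: emeasure_joint)
  also have "\<dots> \<le> (\<integral>\<^sup>+\<omega>. 1 \<partial>R)"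
    using fibre_mass_bounds by (intro nn_integral_mono) (simp add: space_R)
  finally show "emeasure (joint R) (space (joint R)) \<noteq> \<infinity>"
    by (auto simp: R.emeasure_eq_measure top_unique)
qed

end

lemma sets_Ann [simp]: "sets Ann = sets Ext" and space_Ann [simp]: "space Ann = space Ext"
  by (simp_all add: Ann_eq_joint sets_P)

lemma emeasure_Ann_rectangle:
  assumes "u \<in> words W n" "B \<in> sets Env"
  shows "emeasure Ann (B \<times> cylinder W u) = (\<integral>\<^sup>+\<omega>. ennreal (p \<omega> u) * indicator B \<omega> \<partial>P)"
  unfolding Ann_eq_joint by (rule emeasure_joint_rectangle[OF sets_P assms])

lemma fst_measurable_Ext [measurable]: "fst \<in> measurable Ext Env"
  and snd_measurable_Ext [measurable]: "snd \<in> measurable Ext Paths"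
  by (simp_all add: extended_space_def)

sublocale Ann: prob_space Ann
proof (rule prob_spaceI)
  have "space Ann = space Env \<times> cylinder W []" by (simp add: space_extended_space)
  then have "emeasure Ann (space Ann) = (\<integral>\<^sup>+\<omega>. ennreal (p \<omega> []) * indicator (space Env) \<omega> \<partial>P)"
    using emeasure_Ann_rectangle[of "[]" 0 "space Env"] by simp
  also have "\<dots> = (\<integral>\<^sup>+\<omega>. 1 \<partial>P)" by (intro nn_integral_cong) (simp add: p_Nil space_P)
  finally show "emeasure Ann (space Ann) = 1" by (simp add: P.emeasure_space_1)
qed

lemma fst_measurable_Ann [measurable]: "fst \<in> measurable Ann Env"
  using fst_measurable_Ext by (simp add: measurable_cong_sets[OF sets_Ann refl])

lemma walker_map_measurable [measurable]: "walker_map \<in> measurable Ext Ext"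
proof -
  have "(\<lambda>x. snd x 0) \<in> measurable Ext (count_space W)"
    by (rule measurable_compose[OF snd_measurable_Ext coordinate_measurable])
  then have 1: "(\<lambda>x. translate (snd x 0) (fst x)) \<in> measurable Ext Env"
    by (rule measurable_compose_countable'[where I=W and f="\<lambda>z x. translate z (fst x)", rotated])
      (rule countable_finite[OF finite_W], rule measurable_compose[OF fst_measurable_Ext translate_measurable])
  have 2: "(\<lambda>x. \<lambda>k. snd x (Suc k)) \<in> measurable Ext Paths"
    by (rule measurable_into_path_space) (rule measurable_compose[OF snd_measurable_Ext coordinate_measurable])
  show ?thesis
    using measurable_Pair[OF 1 2] unfolding extended_space_def walker_map_eq[abs_def] .
qed

lemma walker_map_funpow_measurable [measurable]: "walker_map ^^ k \<in> measurable Ext Ext"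
  by (rule measurable_compose_n) (rule walker_map_measurable)

text \<open>Up to time \<open>k\<close> the walker moves along some word \<open>u\<close>; the environment seen at time \<open>k\<close> is then
  translated by \<open>sum_list u\<close>.\<close>

lemma emeasure_horizon_walker_rectangle:
  assumes v: "v \<in> words W n" and B: "B \<in> sets Env" and D: "\<forall>u\<in>words W k. D u \<in> sets Env"
  shows "emeasure Ann (horizon_set A W k D \<inter> ((walker_map ^^ k) -` (B \<times> cylinder W v) \<inter> space Ext)) =
    (\<Sum>u\<in>words W k. \<integral>\<^sup>+\<omega>. ennreal (p \<omega> (u @ v)) *
      indicator (D u \<inter> (translate (sum_list u) -` B \<inter> space Env)) \<omega> \<partial>P)"
proof -
  let ?B = "\<lambda>u. D u \<inter> (translate (sum_list u) -` B \<inter> space Env)"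
  have B': "?B u \<in> sets Env" if "u \<in> words W k" for u
    using D that measurable_sets[OF translate_measurable B] by blast
  have uv: "u @ v \<in> words W (k + n)" if "u \<in> words W k" for u using append_in_words[OF that v] .
  have "x \<in> horizon_set A W k D \<inter> ((walker_map ^^ k) -` (B \<times> cylinder W v) \<inter> space Ext) \<longleftrightarrow>
      x \<in> (\<Union>u\<in>words W k. ?B u \<times> cylinder W (u @ v))" for x
  proof -
    have cyl: "snd x \<in> cylinder W (u @ v) \<longleftrightarrow> snd x \<in> space Paths \<and> segment (snd x) 0 k = u \<and>
        segment (\<lambda>j. snd x (k + j)) 0 n = v" if u: "u \<in> words W k" for u
      using u unfolding in_cylinder[OF uv[OF u]] segment_add by (auto simp: words_def)
    let ?u = "segment (snd x) 0 k" and ?v = "segment (\<lambda>j. snd x (k + j)) 0 n"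
    have shift: "(\<lambda>j. snd x (k + j)) \<in> space Paths" if "snd x \<in> space Paths"
      using that by (simp add: in_space_path_space)
    have "x \<in> horizon_set A W k D \<inter> ((walker_map ^^ k) -` (B \<times> cylinder W v) \<inter> space Ext) \<longleftrightarrow>
        x \<in> space Ext \<and> fst x \<in> D ?u \<and> translate (sum_list ?u) (fst x) \<in> B \<and> ?v = v"
      unfolding horizon_set_def mem_Collect_eq Int_iff vimage_eq walker_map_funpow mem_Times_iff
        in_cylinder[OF v] space_extended_space position_eq_sum_list fst_conv snd_conv
      using shift by blast
    also have "\<dots> \<longleftrightarrow> (\<exists>u\<in>words W k. fst x \<in> ?B u \<and> snd x \<in> space Paths \<and> ?u = u \<and> ?v = v)"
      unfolding space_extended_space mem_Times_iff Int_iff vimage_eq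
      using initial_segment_in_words[of "snd x" W k] by blast
    also have "\<dots> \<longleftrightarrow> x \<in> (\<Union>u\<in>words W k. ?B u \<times> cylinder W (u @ v))"
      unfolding UN_iff mem_Times_iff using cyl by blast
    finally show ?thesis .
  qed
  then have preimage: "horizon_set A W k D \<inter> ((walker_map ^^ k) -` (B \<times> cylinder W v) \<inter> space Ext) =
      (\<Union>u\<in>words W k. ?B u \<times> cylinder W (u @ v))" by (rule set_eqI)
  have additive: "emeasure Ann (\<Union>u\<in>words W k. ?B u \<times> cylinder W (u @ v)) =
      (\<Sum>u\<in>words W k. emeasure Ann (?B u \<times> cylinder W (u @ v)))"
  proof (rule sum_emeasure[symmetric])
    have "cylinder W (u @ v) \<inter> cylinder W (u' @ v) = {}"
      if "u \<in> words W k" "u' \<in> words W k" "u \<noteq> u'" for u u'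
      using that in_cylinder[OF uv] by auto
    then show "disjoint_family_on (\<lambda>u. ?B u \<times> cylinder W (u @ v)) (words W k)"
      by (simp add: disjoint_family_on_def Times_Int_Times)
    show "(\<lambda>u. ?B u \<times> cylinder W (u @ v)) ` words W k \<subseteq> sets Ann"
      using B' uv by (auto intro!: rectangle_sets finite_W)
  qed (rule finite_words[OF finite_W])
  show ?thesis
    unfolding preimage additive
    by (intro sum.cong refl emeasure_Ann_rectangle[OF uv B'])
qed

text \<open>Translating the environment by \<open>- sum_list u\<close> makes the sum in the condition (Abs) appear.\<close>

lemma emeasure_walker_map_rectangle:
  assumes v: "v \<in> words W n" and B: "B \<in> sets Env"
  shows "emeasure Ann ((walker_map ^^ k) -` (B \<times> cylinder W v) \<inter> space Ext) =
    (\<integral>\<^sup>+\<omega>. (\<Sum>u\<in>words W k. ennreal (p (translate (- sum_list u) \<omega>) (u @ v))) * indicator B \<omega> \<partial>P)"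
proof -
  let ?B = "\<lambda>u. space Env \<inter> (translate (sum_list u) -` B \<inter> space Env)"
  have B': "?B u \<in> sets Env" for u
    using measurable_sets[OF translate_measurable B] by blast
  have uv: "u @ v \<in> words W (k + n)" if "u \<in> words W k" for u using append_in_words[OF that v] .
  have summand: "(\<integral>\<^sup>+\<omega>. ennreal (p \<omega> (u @ v)) * indicator (?B u) \<omega> \<partial>P) =
      (\<integral>\<^sup>+\<omega>. ennreal (p (translate (- sum_list u) \<omega>) (u @ v)) * indicator B \<omega> \<partial>P)"
    if u: "u \<in> words W k" for u
  proof -
    let ?f = "\<lambda>\<omega>. ennreal (p \<omega> (u @ v)) * indicator (?B u) \<omega>"
    have T: "translate (- sum_list u) \<in> measurable P P"
      and inv: "distr P P (translate (- sum_list u)) = P"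
      using invariant_P by (simp_all add: invariant_under_def)
    have "(\<lambda>\<omega>. p \<omega> (u @ v)) \<in> borel_measurable P"
      using p_measurable[OF uv[OF u]] by (simp only: measurable_cong_sets[OF sets_P refl])
    then have f: "?f \<in> borel_measurable P"
      by (intro borel_measurable_times_ennreal borel_measurable_indicator measurable_compose[OF _ measurable_ennreal])
        (simp_all only: B' sets_P)
    have "(\<integral>\<^sup>+\<omega>. ?f \<omega> \<partial>P) = (\<integral>\<^sup>+\<omega>. ?f \<omega> \<partial>distr P P (translate (- sum_list u)))"
      unfolding inv ..
    also have "\<dots> = (\<integral>\<^sup>+\<omega>. ?f (translate (- sum_list u) \<omega>) \<partial>P)"
      by (rule nn_integral_distr[OF T]) (unfold inv, rule f)
    also have "\<dots> = (\<integral>\<^sup>+\<omega>. ennreal (p (translate (- sum_list u) \<omega>) (u @ v)) * indicator B \<omega> \<partial>P)"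
    proof (rule nn_integral_cong)
      fix \<omega> assume "\<omega> \<in> space P"
      then have "translate (- sum_list u) \<omega> \<in> space Env"
        using measurable_space[OF translate_measurable] by (simp add: space_P)
      then show "?f (translate (- sum_list u) \<omega>) =
          ennreal (p (translate (- sum_list u) \<omega>) (u @ v)) * indicator B \<omega>"
        by (simp add: indicator_def translate_add)
    qed
    finally show ?thesis .
  qed
  have whole: "(walker_map ^^ k) -` (B \<times> cylinder W v) \<inter> space Ext =
      horizon_set A W k (\<lambda>_. space Env) \<inter> ((walker_map ^^ k) -` (B \<times> cylinder W v) \<inter> space Ext)"
    unfolding horizon_set_def space_extended_space by auto
  have sets_whole: "\<forall>u\<in>words W k. space Env \<in> sets Env" by simp
  have "emeasure Ann ((walker_map ^^ k) -` (B \<times> cylinder W v) \<inter> space Ext) =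
      (\<Sum>u\<in>words W k. \<integral>\<^sup>+\<omega>. ennreal (p (translate (- sum_list u) \<omega>) (u @ v)) * indicator B \<omega> \<partial>P)"
    by (subst whole, subst emeasure_horizon_walker_rectangle[OF v B sets_whole]) (intro sum.cong refl summand)
  also have "\<dots> = (\<integral>\<^sup>+\<omega>. (\<Sum>u\<in>words W k. ennreal (p (translate (- sum_list u) \<omega>) (u @ v)) * indicator B \<omega>) \<partial>P)"
  proof (rule nn_integral_sum[symmetric])
    fix u assume u: "u \<in> words W k"
    show "(\<lambda>\<omega>. ennreal (p (translate (- sum_list u) \<omega>) (u @ v)) * indicator B \<omega>) \<in> borel_measurable P"
    proof (intro borel_measurable_times_ennreal borel_measurable_indicator)
      have "(\<lambda>\<omega>. p (translate (- sum_list u) \<omega>) (u @ v)) \<in> borel_measurable P"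
        using measurable_compose[OF translate_measurable p_measurable[OF uv[OF u]]]
        by (simp only: measurable_cong_sets[OF sets_P refl])
      then show "(\<lambda>\<omega>. ennreal (p (translate (- sum_list u) \<omega>) (u @ v))) \<in> borel_measurable P"
        by simp
    qed (simp add: B sets_P)
  qed
  finally show ?thesis unfolding sum_distrib_right .
qed

end

section \<open>Images of the annealed measure\<close>

context random_walk
begin

lemma AE_translates:
  assumes "AE \<omega> in P. Q \<omega>"
  shows "AE \<omega> in P. \<forall>z. Q (translate z \<omega>)"
proof -
  have "AE \<omega> in P. Q (translate z \<omega>)" for z
  proof (rule AE_distrD[of _ P P])
    show "translate z \<in> measurable P P"
      using invariant_P[of z] by (simp add: invariant_under_def)
    have inv: "distr P P (translate z) = P"
      using invariant_P[of z] by (simp add: invariant_under_def)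
    show "AE \<omega> in distr P P (translate z). Q \<omega>" unfolding inv by fact
  qed
  then show ?thesis by (simp add: AE_all_countable)
qed

lemma AE_P_space: "AE \<omega> in P. \<omega> \<in> space Env"
  using AE_space[of P] by (simp add: space_P)

lemma translate_in_space: "\<omega> \<in> space Env \<Longrightarrow> translate z \<omega> \<in> space Env"
  by (rule measurable_space[OF translate_measurable])

lemma AE_positive_words:
  assumes "cond_Pos W P p"
  shows "AE \<omega> in P. \<forall>n. \<forall>u\<in>words W n. 0 < p \<omega> u"
  using assms unfolding cond_Pos_def
proof eventually_elim
  case (elim \<omega>)
  show ?case
  proof (intro allI ballI)
    fix n u assume "u \<in> words W n"
    then obtain w where "w \<in> space Paths" "segment w 0 n = u" using ex_path_through W_nonempty by blast
    then show "0 < p \<omega> u" using elim by blast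
  qed
qed

lemma AE_backward_sum_bounds:
  assumes Pos: "cond_Pos W P p" and Abs: "cond_Abs W P p"
  obtains C where "1 \<le> C" and
    "AE \<omega> in P. \<forall>n. \<forall>k. \<forall>v\<in>words W n.
       p \<omega> v \<le> C * (\<Sum>u\<in>words W k. p (translate (- sum_list u) \<omega>) (u @ v)) \<and>
       (\<Sum>u\<in>words W k. p (translate (- sum_list u) \<omega>) (u @ v)) \<le> C * p \<omega> v"
proof -
  obtain C where C: "0 < C" and AE: "AE \<omega> in P. \<forall>n. \<forall>k\<ge>1. \<forall>w\<in>space Paths.
        (let S = (\<Sum>us\<in>words W k.
               p (translate (- sum_list us) \<omega>) (us @ segment w 0 n) / p \<omega> (segment w 0 n))
         in inverse C \<le> S \<and> S \<le> C)"
    using Abs unfolding cond_Abs_def by blast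
  have "AE \<omega> in P. \<forall>n. \<forall>k. \<forall>v\<in>words W n.
       p \<omega> v \<le> max 1 C * (\<Sum>u\<in>words W k. p (translate (- sum_list u) \<omega>) (u @ v)) \<and>
       (\<Sum>u\<in>words W k. p (translate (- sum_list u) \<omega>) (u @ v)) \<le> max 1 C * p \<omega> v"
    using AE AE_positive_words[OF Pos]
  proof eventually_elim
    case (elim \<omega>)
    show ?case
    proof (intro allI ballI)
      fix n k v assume v: "v \<in> words W n"
      let ?S = "\<Sum>u\<in>words W k. p (translate (- sum_list u) \<omega>) (u @ v)"
      have p0: "0 < p \<omega> v" using elim(2) v by blast
      show "p \<omega> v \<le> max 1 C * ?S \<and> ?S \<le> max 1 C * p \<omega> v"
      proof (cases "k = 0")
        case True
        then have "?S = p \<omega> v" by simp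
        with p0 show ?thesis by (simp add: max_def mult_le_cancel_right1)
      next
        case False
        obtain w where w: "w \<in> space Paths" "segment w 0 n = v"
          using ex_path_through[OF v W_nonempty] by blast
        have "inverse C \<le> ?S / p \<omega> v \<and> ?S / p \<omega> v \<le> C"
          using elim(1)[rule_format, of k w n] w False by (simp add: Let_def sum_divide_distrib)
        then have "p \<omega> v \<le> C * ?S" "?S \<le> C * p \<omega> v"
          using p0 C by (simp_all add: field_simps)
        moreover have "0 \<le> ?S" using calculation(1) p0 C by (meson less_le_trans less_imp_le zero_le_mult_iff not_less)
        moreover have "C * ?S \<le> max 1 C * ?S" "C * p \<omega> v \<le> max 1 C * p \<omega> v"
          using p0 calculation(3) by (auto intro!: mult_right_mono)
        ultimately show ?thesis by linarith
      qed
    qed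
  qed
  then show ?thesis by (intro that[of "max 1 C"]) auto
qed

lemma walker_map_funpow_measurable_Ann [measurable]: "walker_map ^^ k \<in> measurable Ann Ext"
  using walker_map_funpow_measurable by (simp only: measurable_cong_sets[OF sets_Ann refl])

text \<open>By translation invariance, comparing the image measures with the annealed measure on rectangles
  amounts to integrating the condition (Abs).\<close>

lemma iterated_images_equivalent:
  assumes Pos: "cond_Pos W P p" and Abs: "cond_Abs W P p"
  obtains C where "1 \<le> C"
    and "\<And>k S. S \<in> sets Ext \<Longrightarrow> emeasure Ann S \<le> ennreal C * emeasure Ann ((walker_map ^^ k) -` S \<inter> space Ext)"
    and "\<And>k S. S \<in> sets Ext \<Longrightarrow> emeasure Ann ((walker_map ^^ k) -` S \<inter> space Ext) \<le> ennreal C * emeasure Ann S"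
proof -
  obtain C where C: "1 \<le> C" and AE: "AE \<omega> in P. \<forall>n. \<forall>k. \<forall>v\<in>words W n.
       p \<omega> v \<le> C * (\<Sum>u\<in>words W k. p (translate (- sum_list u) \<omega>) (u @ v)) \<and>
       (\<Sum>u\<in>words W k. p (translate (- sum_list u) \<omega>) (u @ v)) \<le> C * p \<omega> v"
    using AE_backward_sum_bounds[OF Pos Abs] .
  have C0: "0 \<le> C" using C by simp
  define N where "N k = distr Ann Ext (walker_map ^^ k)" for k
  have N_emeasure: "emeasure (N k) S = emeasure Ann ((walker_map ^^ k) -` S \<inter> space Ext)"
    if "S \<in> sets Ext" for k S
    using emeasure_distr[OF walker_map_funpow_measurable_Ann that] by (simp add: N_def)
  have N_finite: "finite_measure (N k)" for k
    unfolding N_def by (intro Ann.finite_measure_distr walker_map_funpow_measurable_Ann)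
  have N_sets: "sets (N k) = sets Ext" for k by (simp add: N_def)
  let ?p = "\<lambda>v \<omega>. ennreal (p \<omega> v)"
  let ?s = "\<lambda>k v \<omega>. \<Sum>u\<in>words W k. ennreal (p (translate (- sum_list u) \<omega>) (u @ v))"
  have rectangles: "emeasure Ann (B \<times> cylinder W v) \<le> ennreal C * emeasure (N k) (B \<times> cylinder W v) \<and>
      emeasure (N k) (B \<times> cylinder W v) \<le> ennreal C * emeasure Ann (B \<times> cylinder W v)"
    if v: "v \<in> words W n" and B: "B \<in> sets Env" for n k v B
  proof -
    have pm: "?p v \<in> borel_measurable P"
      using p_measurable[OF v] by (simp add: measurable_cong_sets[OF sets_P refl])
    have "(\<lambda>\<omega>. p (translate (- sum_list u) \<omega>) (u @ v)) \<in> borel_measurable P" if "u \<in> words W k" for u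
      using measurable_compose[OF translate_measurable p_measurable[OF append_in_words[OF that v]]]
      by (simp only: measurable_cong_sets[OF sets_P refl])
    then have sm: "?s k v \<in> borel_measurable P" by simp
    have Bm: "(indicator B :: _ \<Rightarrow> ennreal) \<in> borel_measurable P"
      by (rule borel_measurable_indicator) (simp add: sets_P B)
    have bounds: "AE \<omega> in P. ?p v \<omega> \<le> ennreal C * ?s k v \<omega> \<and> ?s k v \<omega> \<le> ennreal C * ?p v \<omega>"
      using AE AE_P_space
    proof eventually_elim
      case (elim \<omega>)
      have "0 \<le> p (translate (- sum_list u) \<omega>) (u @ v)" if "u \<in> words W k" for u
        using p_nonneg[OF translate_in_space[OF elim(2)] append_in_words[OF that v]] .
      moreover have "0 \<le> p \<omega> v" by (rule p_nonneg[OF elim(2) v])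
      ultimately show ?case
        using elim(1) v C0 by (simp add: ennreal_mult[symmetric] sum_nonneg)
    qed
    have rect_N: "emeasure (N k) (B \<times> cylinder W v) = (\<integral>\<^sup>+\<omega>. ?s k v \<omega> * indicator B \<omega> \<partial>P)"
      using emeasure_walker_map_rectangle[OF v B] rectangle_sets[OF finite_W v B] by (simp add: N_emeasure)
    have rect: "emeasure Ann (B \<times> cylinder W v) = (\<integral>\<^sup>+\<omega>. ?p v \<omega> * indicator B \<omega> \<partial>P)"
      by (rule emeasure_Ann_rectangle[OF v B])
    have "(\<integral>\<^sup>+\<omega>. ?p v \<omega> * indicator B \<omega> \<partial>P) \<le> (\<integral>\<^sup>+\<omega>. ennreal C * (?s k v \<omega> * indicator B \<omega>) \<partial>P)"
    proof (rule nn_integral_mono_AE)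
      show "AE \<omega> in P. ?p v \<omega> * indicator B \<omega> \<le> ennreal C * (?s k v \<omega> * indicator B \<omega>)"
        using bounds by eventually_elim (auto simp: indicator_def)
    qed
    moreover have "(\<integral>\<^sup>+\<omega>. ?s k v \<omega> * indicator B \<omega> \<partial>P) \<le> (\<integral>\<^sup>+\<omega>. ennreal C * (?p v \<omega> * indicator B \<omega>) \<partial>P)"
    proof (rule nn_integral_mono_AE)
      show "AE \<omega> in P. ?s k v \<omega> * indicator B \<omega> \<le> ennreal C * (?p v \<omega> * indicator B \<omega>)"
        using bounds by eventually_elim (auto simp: indicator_def)
    qed
    ultimately show ?thesis
      unfolding rect rect_N
      using nn_integral_cmult[OF borel_measurable_times_ennreal[OF sm Bm], of "ennreal C"]
        nn_integral_cmult[OF borel_measurable_times_ennreal[OF pm Bm], of "ennreal C"] by simp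
  qed
  show ?thesis
  proof (rule that[OF C])
    fix k S assume S: "S \<in> sets Ext"
    have "emeasure Ann S \<le> ennreal C * emeasure (N k) S"
      by (rule emeasure_domination_from_rectangles[OF finite_W Ann.finite_measure_axioms sets_Ann N_finite N_sets C0 _ S])
        (use rectangles in blast)
    then show "emeasure Ann S \<le> ennreal C * emeasure Ann ((walker_map ^^ k) -` S \<inter> space Ext)"
      by (simp add: N_emeasure[OF S])
    have "emeasure (N k) S \<le> ennreal C * emeasure Ann S"
      by (rule emeasure_domination_from_rectangles[OF finite_W N_finite N_sets Ann.finite_measure_axioms sets_Ann C0 _ S])
        (use rectangles in blast)
    then show "emeasure Ann ((walker_map ^^ k) -` S \<inter> space Ext) \<le> ennreal C * emeasure Ann S"
      by (simp add: N_emeasure[OF S])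
  qed
qed

end

section \<open>Restarting the walker\<close>

text \<open>The Weierstrass inequality \<open>\<Prod>(1 - x\<^sub>j) \<ge> 1 - \<Sum>x\<^sub>j\<close> bounds the factors from \<open>j0\<close> on; the
  factors before \<open>j0\<close> are only known to be at least \<open>g\<close>.\<close>

lemma product_lower_bound:
  fixes x :: "nat \<Rightarrow> real"
  assumes x: "\<And>j. j0 \<le> j \<Longrightarrow> 0 \<le> x j" "\<And>n. (\<Sum>j<n. x (j0 + j)) \<le> 1 / 2"
    and g: "0 < g" "g \<le> 1"
  shows "g ^ j0 / 2 \<le> (\<Prod>j<n. if j < j0 then g else 1 - x j)"
proof -
  let ?b = "\<lambda>j. if j < j0 then g else 1 - x j"
  have x1: "x j \<le> 1" if "j0 \<le> j" for j
  proof -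
    have "x (j0 + (j - j0)) \<le> (\<Sum>i<Suc (j - j0). x (j0 + i))"
      using x(1) by (intro member_le_sum) auto
    also have "\<dots> \<le> 1 / 2" by (rule x(2))
    finally show ?thesis using that by simp
  qed
  have "g ^ j0 * (1 - (\<Sum>j<m. x (j0 + j))) \<le> (\<Prod>j<j0 + m. ?b j)" for m
  proof (induction m)
    case 0
    have "(\<Prod>j<j0. ?b j) = (\<Prod>j<j0. g)" by (intro prod.cong) auto
    then show ?case by simp
  next
    case (Suc m)
    let ?S = "\<Sum>j<m. x (j0 + j)"
    have S0: "0 \<le> ?S" using x(1) by (intro sum_nonneg) simp
    have "1 - ?S - x (j0 + m) \<le> (1 - ?S) * (1 - x (j0 + m))"
      using mult_nonneg_nonneg[OF S0 x(1)[of "j0 + m"]] by (simp add: algebra_simps)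
    then have "g ^ j0 * (1 - ?S - x (j0 + m)) \<le> g ^ j0 * (1 - ?S) * (1 - x (j0 + m))"
      using g by (simp add: mult.assoc)
    also have "\<dots> \<le> (\<Prod>j<j0 + m. ?b j) * (1 - x (j0 + m))"
      using Suc.IH x1[of "j0 + m"] by (intro mult_right_mono) auto
    finally show ?case by (simp add: algebra_simps)
  qed
  from this[of n] have "g ^ j0 * (1 / 2) \<le> (\<Prod>j<j0 + n. ?b j)"
    using x(2)[of n] g by (elim order_trans[rotated]) (intro mult_left_mono, auto)
  also have "(\<Prod>j<n + k. ?b j) \<le> (\<Prod>j<n. ?b j)" for k
  proof (induction k)
    case (Suc k)
    have "(\<Prod>j<n + k. ?b j) * ?b (n + k) \<le> (\<Prod>j<n + k. ?b j)"
      using g x(1)[of "n + k"] x1 by (intro mult_left_le prod_nonneg) auto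
    with Suc.IH show ?case by simp
  qed simp
  from this[of j0] have "(\<Prod>j<j0 + n. ?b j) \<le> (\<Prod>j<n. ?b j)" by (simp only: add.commute)
  finally show ?thesis by simp
qed

context random_walk
begin

text \<open>After a long word \<open>u\<close> the next letters are chosen almost as by a walker who starts afresh at
  the endpoint of \<open>u\<close>. By (Exp) and (Ell) the ratio of the two conditional probabilities of the
  \<open>j\<close>-th letter is at least \<open>1 - (C / \<gamma>) \<nu>\<^sup>j\<close> for large \<open>j\<close>, which is summable, and at least \<open>\<gamma>\<close> for
  the remaining \<open>j\<close>.\<close>

lemma AE_restart:
  assumes Pos: "cond_Pos W P p" and Exp: "cond_Exp W P p" and Ell: "cond_Ell W P p"
  obtains c N where "0 < c" and
    "AE \<omega> in P. \<forall>m\<ge>N. \<forall>n. \<forall>u\<in>words W m. \<forall>v\<in>words W n.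
       c * (p \<omega> u * p (translate (sum_list u) \<omega>) v) \<le> p \<omega> (u @ v)"
proof -
  obtain C \<nu> where C: "0 < C" and \<nu>: "0 < \<nu>" "\<nu> < 1" and AE_Exp: "AE \<omega> in P. \<forall>n m. m < n \<longrightarrow> (\<forall>w\<in>space Paths.
           \<bar>cond_step p \<omega> (segment w 0 n) (w n)
             - cond_step p (translate (position w m) \<omega>) (segment w m n) (w n)\<bar> \<le> C * \<nu> ^ (n - m))"
    using Exp unfolding cond_Exp_def by blast
  obtain \<gamma> N where \<gamma>: "0 < \<gamma>" and AE_Ell: "AE \<omega> in P. \<forall>n\<ge>N. \<forall>w\<in>space Paths. cond_step p \<omega> (segment w 0 n) (w n) \<ge> \<gamma>"
    using Ell unfolding cond_Ell_def by blast
  define g where "g = min \<gamma> 1"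
  have g: "0 < g" "g \<le> 1" "g \<le> \<gamma>" using \<gamma> by (auto simp: g_def)
  \<comment> \<open>From the index \<open>j0\<close> on, (Ell) applies to the restarted walker and the relative errors
    \<open>(C / g) \<nu>\<^sup>j\<close> sum up to at most \<open>1 / 2\<close>.\<close>
  obtain j1 where j1: "\<nu> ^ j1 < g * (1 - \<nu>) / (2 * C)"
    using real_arch_pow_inv[of "g * (1 - \<nu>) / (2 * C)" \<nu>] g \<nu> C by auto
  define j0 where "j0 = max j1 (max 1 N)"
  have "\<nu> ^ j0 \<le> \<nu> ^ j1" using \<nu> by (intro power_decreasing) (auto simp: j0_def)
  with j1 have j0_small: "\<nu> ^ j0 < g * (1 - \<nu>) / (2 * C)" by simp
  define x where "x j = C / g * \<nu> ^ j" for j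
  have x0: "0 \<le> x j" for j using C g \<nu> by (simp add: x_def)
  have x_sum: "(\<Sum>j<n. x (j0 + j)) \<le> 1 / 2" for n
  proof -
    have "(\<Sum>j<n. x (j0 + j)) = C / g * \<nu> ^ j0 * (\<Sum>j<n. \<nu> ^ j)"
      by (simp add: x_def power_add sum_distrib_left sum_divide_distrib mult_ac)
    also have "\<dots> \<le> C / g * \<nu> ^ j0 * (1 / (1 - \<nu>))"
      using C g \<nu> by (intro mult_left_mono) (simp_all add: sum_gp_strict divide_right_mono)
    also have "\<dots> \<le> C / g * (g * (1 - \<nu>) / (2 * C)) * (1 / (1 - \<nu>))"
      using C g \<nu> j0_small by (intro mult_right_mono mult_left_mono) auto
    also have "\<dots> = 1 / 2" using C g \<nu> by (simp add: field_simps)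
    finally show ?thesis .
  qed
  define b where "b j = (if j < j0 then g else 1 - x j)" for j
  have b0: "0 \<le> b j" for j
  proof (cases "j < j0")
    case False
    have "x j \<le> x j0"
      unfolding x_def using False C g \<nu> by (intro mult_left_mono power_decreasing) auto
    with x_sum[of 1] False show ?thesis by (simp add: b_def)
  qed (use g in \<open>simp add: b_def\<close>)
  have prod_b: "g ^ j0 / 2 \<le> (\<Prod>j<n. b j)" for n
    unfolding b_def by (rule product_lower_bound) (use x0 x_sum g in auto)
  have "AE \<omega> in P. \<forall>m\<ge>N. \<forall>n. \<forall>u\<in>words W m. \<forall>v\<in>words W n.
       g ^ j0 / 2 * (p \<omega> u * p (translate (sum_list u) \<omega>) v) \<le> p \<omega> (u @ v)"
    using AE_Exp AE_translates[OF AE_Ell] AE_translates[OF AE_positive_words[OF Pos]] AE_P_space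
  proof eventually_elim
    case (elim \<omega>)
    note exp = elim(1) and ell = elim(2) and pos = elim(3) and \<omega> = elim(4)
    have step_ge: "\<gamma> \<le> cond_step p (translate z \<omega>) u a" if u: "u \<in> words W m" and m: "N \<le> m" and a: "a \<in> W" for z u m a
    proof -
      obtain w where w: "w \<in> space Paths" "segment w 0 (Suc m) = u @ [a]"
        using ex_path_through[OF snoc_in_words[OF u a] W_nonempty] by blast
      then show ?thesis using ell m by (auto simp: segment_Suc)
    qed
    have step_le: "cond_step p (translate z \<omega>) u a \<le> 1" if u: "u \<in> words W m" and a: "a \<in> W" for z u m a
    proof -
      have z: "translate z \<omega> \<in> space Env" by (rule translate_in_space[OF \<omega>])
      have "p (translate z \<omega>) (u @ [a]) \<le> (\<Sum>a\<in>W. p (translate z \<omega>) (u @ [a]))"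
        using a finite_W p_nonneg[OF z snoc_in_words[OF u]] by (intro member_le_sum) auto
      then show ?thesis using pos u by (simp add: cond_step_def p_snoc[OF z u, symmetric])
    qed
    have step: "p (translate z \<omega>) (u @ [a]) = p (translate z \<omega>) u * cond_step p (translate z \<omega>) u a"
      if "u \<in> words W m" for z u m a
      using pos that by (auto simp: cond_step_def less_imp_neq[symmetric])
    show ?case
    proof (intro allI impI ballI)
      fix m n u v assume m: "N \<le> m" and u: "u \<in> words W m" and v: "v \<in> words W n"
      let ?\<omega>' = "translate (sum_list u) \<omega>"
      have ratio: "b n * cond_step p ?\<omega>' v a \<le> cond_step p \<omega> (u @ v) a"
        if v: "v \<in> words W n" and a: "a \<in> W" for n v a
      proof (cases "n < j0")
        case True
        have "g * cond_step p ?\<omega>' v a \<le> g * 1"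
          using step_le[OF v a] g by (intro mult_left_mono) auto
        also have "\<dots> \<le> cond_step p \<omega> (u @ v) a"
          using step_ge[OF append_in_words[OF u v] _ a, of 0] m g by simp
        finally show ?thesis using True by (simp add: b_def)
      next
        case False
        then have n: "1 \<le> n" "N \<le> n" by (auto simp: j0_def)
        obtain w where w: "w \<in> space Paths" "segment w 0 (Suc (m + n)) = (u @ v) @ [a]"
          using ex_path_through[OF snoc_in_words[OF append_in_words[OF u v] a] W_nonempty] by blast
        have "segment w 0 (m + n) = u @ v" "w (m + n) = a"
          using w(2) by (auto simp: segment_Suc)
        moreover have "segment w 0 m = u" "segment w m (m + n) = v"
          using calculation(1) u by (auto simp: segment_add segment_shift words_def)
        ultimately have "\<bar>cond_step p \<omega> (u @ v) a - cond_step p ?\<omega>' v a\<bar> \<le> C * \<nu> ^ n"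
          using exp[rule_format, of m "m + n" w] n w(1) by (simp add: position_eq_sum_list)
        moreover have "C * \<nu> ^ n \<le> x n * cond_step p ?\<omega>' v a"
        proof -
          have "C * \<nu> ^ n = x n * g" using g by (simp add: x_def)
          also have "\<dots> \<le> x n * cond_step p ?\<omega>' v a"
            using step_ge[OF v n(2) a, of "sum_list u"] g by (intro mult_left_mono x0) auto
          finally show ?thesis .
        qed
        ultimately show ?thesis using False by (simp add: b_def algebra_simps)
      qed
      have "p \<omega> u * p ?\<omega>' v * (\<Prod>j<n. b j) \<le> p \<omega> (u @ v)"
        using v
      proof (induction n arbitrary: v)
        case 0
        then show ?case by (simp add: p_Nil translate_in_space[OF \<omega>])
      next
        case (Suc n)
        obtain v' a where v': "v = v' @ [a]" "v' \<in> words W n" "a \<in> W"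
        proof (cases v rule: rev_cases)
          case (snoc v' a)
          with Suc.prems show ?thesis by (intro that) (auto simp: words_def)
        qed (use Suc.prems in \<open>simp add: words_def\<close>)
        let ?s = "cond_step p ?\<omega>' v' a"
        have s0: "0 \<le> p \<omega> u * p ?\<omega>' v' * (\<Prod>j<n. b j)"
          using p_nonneg[OF \<omega> u] p_nonneg[OF translate_in_space[OF \<omega>] v'(2)] b0
          by (intro mult_nonneg_nonneg prod_nonneg) auto
        have puv: "0 \<le> p \<omega> (u @ v')" using s0 Suc.IH[OF v'(2)] by simp
        have s1: "0 \<le> ?s"
          using p_nonneg[OF translate_in_space[OF \<omega>] v'(2)]
            p_nonneg[OF translate_in_space[OF \<omega>] snoc_in_words[OF v'(2,3)]] by (simp add: cond_step_def)
        have "p \<omega> u * p ?\<omega>' v * (\<Prod>j<Suc n. b j) = (p \<omega> u * p ?\<omega>' v' * (\<Prod>j<n. b j)) * (b n * ?s)"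
          unfolding v'(1) step[OF v'(2)] by (simp add: mult_ac)
        also have "\<dots> \<le> p \<omega> (u @ v') * (b n * ?s)"
          using Suc.IH[OF v'(2)] b0 s1 by (intro mult_right_mono) auto
        also have "\<dots> \<le> p \<omega> (u @ v') * cond_step p \<omega> (u @ v') a"
          using ratio[OF v'(2,3)] puv by (intro mult_left_mono)
        also have "\<dots> = p \<omega> (u @ v)"
          using step[OF append_in_words[OF u v'(2)], of 0 a] by (simp add: v'(1))
        finally show ?case .
      qed
      moreover have "p \<omega> u * p ?\<omega>' v * (g ^ j0 / 2) \<le> p \<omega> u * p ?\<omega>' v * (\<Prod>j<n. b j)"
        using p_nonneg[OF \<omega> u] p_nonneg[OF translate_in_space[OF \<omega>] v] by (intro mult_left_mono prod_b) auto
      ultimately show "g ^ j0 / 2 * (p \<omega> u * p ?\<omega>' v) \<le> p \<omega> (u @ v)" by (simp add: mult_ac)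
    qed
  qed
  then show ?thesis using g by (intro that[of "g ^ j0 / 2" N]) auto
qed

text \<open>Under the annealed measure restricted to the paths that start with \<open>u\<close>, the law of the
  environment has density \<open>\<lambda>\<omega>. p \<omega> u\<close> with respect to \<open>P\<close>, because both measures agree on rectangles.\<close>

lemma nn_integral_Ann_cylinder:
  assumes u: "u \<in> words W n" and f: "f \<in> borel_measurable Env"
  shows "(\<integral>\<^sup>+x. f (fst x) * indicator (cylinder W u) (snd x) \<partial>Ann) = (\<integral>\<^sup>+\<omega>. ennreal (p \<omega> u) * f \<omega> \<partial>P)"
proof -
  let ?c = "\<lambda>x. indicator (cylinder W u) (snd x) :: ennreal"
  have "snd \<in> measurable Ann Paths"
    using snd_measurable_Ext by (simp only: measurable_cong_sets[OF sets_Ann refl])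
  then have c: "?c \<in> borel_measurable Ann"
    by (rule measurable_compose) (rule borel_measurable_indicator[OF sets_cylinder[OF finite_W u]])
  have pu: "(\<lambda>\<omega>. ennreal (p \<omega> u)) \<in> borel_measurable P"
    using p_measurable[OF u] by (simp add: measurable_cong_sets[OF sets_P refl])
  have fst': "fst \<in> measurable (density Ann ?c) Env"
    using fst_measurable_Ann by (simp only: measurable_cong_sets[OF sets_density refl])
  have "distr (density Ann ?c) Env fst = density P (\<lambda>\<omega>. ennreal (p \<omega> u))"
  proof (rule measure_eqI)
    fix B assume "B \<in> sets (distr (density Ann ?c) Env fst)"
    then have B: "B \<in> sets Env" by simp
    have pre: "fst -` B \<inter> space Ann \<in> sets Ann" by (rule measurable_sets[OF fst_measurable_Ann B])
    have "emeasure (distr (density Ann ?c) Env fst) B = (\<integral>\<^sup>+x. ?c x * indicator (fst -` B \<inter> space Ann) x \<partial>Ann)"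
      using emeasure_distr[OF fst' B] emeasure_density[OF c pre] by simp
    also have "\<dots> = (\<integral>\<^sup>+x. indicator (B \<times> cylinder W u) x \<partial>Ann)"
      using sets.sets_into_space[OF B]
      by (intro nn_integral_cong) (auto simp: indicator_def)
    also have "\<dots> = emeasure Ann (B \<times> cylinder W u)"
      using rectangle_sets[OF finite_W u B] by simp
    also have "\<dots> = emeasure (density P (\<lambda>\<omega>. ennreal (p \<omega> u))) B"
      using emeasure_Ann_rectangle[OF u B] emeasure_density[OF pu, of B] B by (simp add: sets_P)
    finally show "emeasure (distr (density Ann ?c) Env fst) B = emeasure (density P (\<lambda>\<omega>. ennreal (p \<omega> u))) B" .
  qed (simp add: sets_P)
  then have "(\<integral>\<^sup>+\<omega>. f \<omega> \<partial>distr (density Ann ?c) Env fst) = (\<integral>\<^sup>+\<omega>. f \<omega> \<partial>density P (\<lambda>\<omega>. ennreal (p \<omega> u)))"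
    by simp
  moreover have "(\<integral>\<^sup>+\<omega>. f \<omega> \<partial>distr (density Ann ?c) Env fst) = (\<integral>\<^sup>+x. f (fst x) \<partial>density Ann ?c)"
    by (rule nn_integral_distr[OF fst']) (use f in simp)
  moreover have "(\<integral>\<^sup>+x. f (fst x) \<partial>density Ann ?c) = (\<integral>\<^sup>+x. ?c x * f (fst x) \<partial>Ann)"
    by (rule nn_integral_density[OF c measurable_compose[OF fst_measurable_Ann f]])
  moreover have "(\<integral>\<^sup>+\<omega>. f \<omega> \<partial>density P (\<lambda>\<omega>. ennreal (p \<omega> u))) = (\<integral>\<^sup>+\<omega>. ennreal (p \<omega> u) * f \<omega> \<partial>P)"
    by (rule nn_integral_density[OF pu]) (use f in \<open>simp only: measurable_cong_sets[OF sets_P refl]\<close>)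
  ultimately show ?thesis by (simp add: mult.commute)
qed

lemma nn_integral_Ann_segment:
  assumes f: "\<And>u. u \<in> words W n \<Longrightarrow> f u \<in> borel_measurable Env"
  shows "(\<integral>\<^sup>+x. f (segment (snd x) 0 n) (fst x) \<partial>Ann) =
    (\<Sum>u\<in>words W n. \<integral>\<^sup>+\<omega>. ennreal (p \<omega> u) * f u \<omega> \<partial>P)"
proof -
  have "(\<integral>\<^sup>+x. f (segment (snd x) 0 n) (fst x) \<partial>Ann) =
      (\<integral>\<^sup>+x. (\<Sum>u\<in>words W n. f u (fst x) * indicator (cylinder W u) (snd x)) \<partial>Ann)"
  proof (rule nn_integral_cong)
    fix x assume "x \<in> space Ann"
    then have x: "snd x \<in> space Paths" by (simp add: space_extended_space mem_Times_iff)
    have "(\<Sum>u\<in>words W n. f u (fst x) * indicator (cylinder W u) (snd x)) =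
        (\<Sum>u\<in>words W n. if u = segment (snd x) 0 n then f u (fst x) else 0)"
      using x by (intro sum.cong refl) (auto simp: in_cylinder indicator_def)
    also have "\<dots> = f (segment (snd x) 0 n) (fst x)"
      using finite_words[OF finite_W, of n] initial_segment_in_words[OF x, of n] by (simp add: sum.delta)
    finally show "f (segment (snd x) 0 n) (fst x) = (\<Sum>u\<in>words W n. f u (fst x) * indicator (cylinder W u) (snd x))" ..
  qed
  also have "\<dots> = (\<Sum>u\<in>words W n. \<integral>\<^sup>+x. f u (fst x) * indicator (cylinder W u) (snd x) \<partial>Ann)"
  proof (rule nn_integral_sum)
    fix u assume u: "u \<in> words W n"
    have "snd \<in> measurable Ann Paths"
      using snd_measurable_Ext by (simp only: measurable_cong_sets[OF sets_Ann refl])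
    then have "(\<lambda>x. indicator (cylinder W u) (snd x) :: ennreal) \<in> borel_measurable Ann"
      by (rule measurable_compose) (rule borel_measurable_indicator[OF sets_cylinder[OF finite_W u]])
    then show "(\<lambda>x. f u (fst x) * indicator (cylinder W u) (snd x)) \<in> borel_measurable Ann"
      by (rule borel_measurable_times_ennreal[OF measurable_compose[OF fst_measurable_Ann f[OF u]]])
  qed
  also have "\<dots> = (\<Sum>u\<in>words W n. \<integral>\<^sup>+\<omega>. ennreal (p \<omega> u) * f u \<omega> \<partial>P)"
    by (intro sum.cong refl nn_integral_Ann_cylinder f)
  finally show ?thesis .
qed

end

section \<open>Ergodicity of the walker map\<close>

context random_walk
begin

text \<open>The inequality of \<open>AE_restart\<close> compares two measures on rectangles: the law of the walk
  after time \<open>n\<close>, and the law obtained by restarting the walker at time \<open>n\<close> in the environment seen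
  then, both on the event \<open>horizon_set A W n D\<close>. Hence the comparison extends to all events.\<close>

lemma restart_inequality:
  assumes c: "0 < c" and AE: "AE \<omega> in P. \<forall>m\<ge>N. \<forall>k. \<forall>u\<in>words W m. \<forall>v\<in>words W k.
       c * (p \<omega> u * p (translate (sum_list u) \<omega>) v) \<le> p \<omega> (u @ v)"
    and n: "N \<le> n" and D: "\<forall>u\<in>words W n. D u \<in> sets Env" and S: "S \<in> sets Ext"
  shows "(\<integral>\<^sup>+x. indicator (horizon_set A W n D) x * ennreal (fibre_mass S (fst ((walker_map ^^ n) x))) \<partial>Ann)
    \<le> ennreal (1 / c) * emeasure Ann (horizon_set A W n D \<inter> ((walker_map ^^ n) -` S \<inter> space Ext))"
proof -
  let ?D = "horizon_set A W n D" and ?F = "walker_map ^^ n"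
  let ?i = "indicator ?D :: _ \<Rightarrow> ennreal"
  let ?e = "\<lambda>x. fst (?F x)"
  have D_sets: "?D \<in> sets Ann"
    using sets_finite_horizon[OF finite_W horizon_setI[OF D]] by simp
  then have i: "?i \<in> borel_measurable Ann" by (rule borel_measurable_indicator)
  define L where "L = density Ann ?i"
  have L_sets: "sets L = sets Ext" by (simp add: L_def)
  have L_space: "space L = space Ext" by (simp add: L_def)
  have F: "?F \<in> measurable L Ext"
    using walker_map_funpow_measurable by (simp only: measurable_cong_sets[OF L_sets refl])
  have e: "?e \<in> measurable L Env" by (rule measurable_compose[OF F fst_measurable_Ext])
  have L_emeasure: "emeasure L S = emeasure Ann (?D \<inter> S)" if "S \<in> sets Ext" for S
  proof -
    have "emeasure L S = (\<integral>\<^sup>+x. indicator (?D \<inter> S) x \<partial>Ann)"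
      using that i by (simp add: L_def emeasure_density indicator_inter_arith)
    then show ?thesis using that D_sets by simp
  qed
  have L_finite: "finite_measure L"
  proof (rule finite_measureI)
    show "emeasure L (space L) \<noteq> \<infinity>" by (simp add: L_space L_emeasure Ann.emeasure_eq_measure)
  qed
  define R where "R = distr L Env ?e"
  have R_sets: "sets R = sets Env" by (simp add: R_def)
  have R_finite: "finite_measure R"
    unfolding R_def by (rule finite_measure.finite_measure_distr[OF L_finite e])
  have R_integral: "(\<integral>\<^sup>+\<omega>. f \<omega> \<partial>R) = (\<integral>\<^sup>+x. ?i x * f (?e x) \<partial>Ann)" if f: "f \<in> borel_measurable Env" for f
  proof -
    have "(\<integral>\<^sup>+\<omega>. f \<omega> \<partial>R) = (\<integral>\<^sup>+x. f (?e x) \<partial>L)"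
      unfolding R_def by (rule nn_integral_distr[OF e]) (use f in simp)
    also have "\<dots> = (\<integral>\<^sup>+x. ?i x * f (?e x) \<partial>Ann)"
      unfolding L_def
    proof (rule nn_integral_density[OF i])
      show "(\<lambda>x. f (?e x)) \<in> borel_measurable Ann"
        using measurable_compose[OF measurable_compose[OF walker_map_funpow_measurable fst_measurable_Ext] f]
        by (simp only: measurable_cong_sets[OF sets_Ann refl])
    qed
    finally show ?thesis .
  qed
  define M where "M = distr L Ext ?F"
  have M_sets: "sets M = sets Ext" by (simp add: M_def)
  have M_finite: "finite_measure M"
    unfolding M_def by (rule finite_measure.finite_measure_distr[OF L_finite F])
  have M_emeasure: "emeasure M S = emeasure Ann (?D \<inter> (?F -` S \<inter> space Ext))" if "S \<in> sets Ext" for S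
    using L_emeasure[OF measurable_sets[OF walker_map_funpow_measurable that, of n]]
      emeasure_distr[OF F that] by (simp add: M_def L_space)
  have fm: "(\<lambda>\<omega>. ennreal (fibre_mass S \<omega>)) \<in> borel_measurable Env"
    using fibre_mass_measurable[OF S] by simp
  have "emeasure (joint R) S \<le> ennreal (1 / c) * emeasure M S"
  proof (rule emeasure_domination_from_rectangles[OF finite_W finite_joint[OF R_sets R_finite]
        sets_joint[OF R_sets] M_finite M_sets _ _ S])
    show "0 \<le> 1 / c" using c by simp
    fix k v and B :: "((int ^ 'd) \<Rightarrow> 'a) set"
    assume v: "v \<in> words W k" and B: "B \<in> sets Env"
    let ?f = "\<lambda>u \<omega>. indicator (D u) \<omega> *
      (ennreal (p (translate (sum_list u) \<omega>) v) * indicator B (translate (sum_list u) \<omega>)) :: ennreal"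
    let ?B = "\<lambda>u. D u \<inter> (translate (sum_list u) -` B \<inter> space Env)"
    have pB: "(\<lambda>\<omega>. ennreal (p \<omega> v) * indicator B \<omega>) \<in> borel_measurable Env"
      using p_measurable[OF v] B by (intro borel_measurable_times_ennreal) simp_all
    have f: "?f u \<in> borel_measurable Env" if "u \<in> words W n" for u
      using D that by (intro borel_measurable_times_ennreal[OF _ measurable_compose[OF translate_measurable pB]]) simp
    have q: "(\<lambda>\<omega>. ennreal (p \<omega> (u @ v)) * indicator (?B u) \<omega>) \<in> borel_measurable P" if u: "u \<in> words W n" for u
    proof -
      have "?B u \<in> sets Env" using D u measurable_sets[OF translate_measurable B] by blast
      then have "(\<lambda>\<omega>. ennreal (p \<omega> (u @ v)) * indicator (?B u) \<omega>) \<in> borel_measurable Env"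
        using p_measurable[OF append_in_words[OF u v]] by (intro borel_measurable_times_ennreal) simp_all
      then show ?thesis by (simp only: measurable_cong_sets[OF sets_P refl])
    qed
    have "emeasure (joint R) (B \<times> cylinder W v) = (\<integral>\<^sup>+x. ?i x * (ennreal (p (?e x) v) * indicator B (?e x)) \<partial>Ann)"
      unfolding emeasure_joint_rectangle[OF R_sets v B] by (rule R_integral[OF pB])
    also have "\<dots> = (\<integral>\<^sup>+x. ?f (segment (snd x) 0 n) (fst x) \<partial>Ann)"
    proof (rule nn_integral_cong)
      fix x assume "x \<in> space Ann"
      then have "?i x = indicator (D (segment (snd x) 0 n)) (fst x)"
        by (simp add: horizon_set_def indicator_def)
      then show "?i x * (ennreal (p (?e x) v) * indicator B (?e x)) = ?f (segment (snd x) 0 n) (fst x)"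
        by (simp add: walker_map_funpow position_eq_sum_list)
    qed
    also have "\<dots> = (\<Sum>u\<in>words W n. \<integral>\<^sup>+\<omega>. ennreal (p \<omega> u) * ?f u \<omega> \<partial>P)"
      by (rule nn_integral_Ann_segment[OF f])
    also have "\<dots> \<le> (\<Sum>u\<in>words W n. \<integral>\<^sup>+\<omega>. ennreal (1 / c) * (ennreal (p \<omega> (u @ v)) * indicator (?B u) \<omega>) \<partial>P)"
    proof (intro sum_mono nn_integral_mono_AE)
      fix u assume u: "u \<in> words W n"
      show "AE \<omega> in P. ennreal (p \<omega> u) * ?f u \<omega> \<le> ennreal (1 / c) * (ennreal (p \<omega> (u @ v)) * indicator (?B u) \<omega>)"
        using AE AE_P_space
      proof eventually_elim
        case (elim \<omega>)
        have "c * (p \<omega> u * p (translate (sum_list u) \<omega>) v) \<le> p \<omega> (u @ v)"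
          using elim(1) n u v by blast
        then have "p \<omega> u * p (translate (sum_list u) \<omega>) v \<le> 1 / c * p \<omega> (u @ v)"
          using c by (simp add: field_simps)
        then have "ennreal (p \<omega> u) * ennreal (p (translate (sum_list u) \<omega>) v) \<le> ennreal (1 / c) * ennreal (p \<omega> (u @ v))"
          using c p_nonneg[OF elim(2) u] p_nonneg[OF translate_in_space[OF elim(2)] v]
            p_nonneg[OF elim(2) append_in_words[OF u v]]
          by (simp only: ennreal_mult[symmetric] ennreal_leI zero_le_divide_1_iff less_imp_le)
        then show ?case using elim(2) by (simp add: indicator_def)
      qed
    qed
    also have "\<dots> = (\<Sum>u\<in>words W n. ennreal (1 / c) * (\<integral>\<^sup>+\<omega>. ennreal (p \<omega> (u @ v)) * indicator (?B u) \<omega> \<partial>P))"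
      by (intro sum.cong refl nn_integral_cmult q)
    also have "\<dots> = ennreal (1 / c) * emeasure M (B \<times> cylinder W v)"
      unfolding M_emeasure[OF rectangle_sets[OF finite_W v B]] emeasure_horizon_walker_rectangle[OF v B D]
      by (simp only: sum_distrib_left)
    finally show "emeasure (joint R) (B \<times> cylinder W v) \<le> ennreal (1 / c) * emeasure M (B \<times> cylinder W v)" .
  qed
  then show ?thesis
    unfolding emeasure_joint[OF R_sets S] R_integral[OF fm] M_emeasure[OF S] .
qed

lemma fibre_mass_compl:
  assumes \<omega>: "\<omega> \<in> space Env" and S: "S \<in> sets Ext"
  shows "fibre_mass (space Ext - S) \<omega> = 1 - fibre_mass S \<omega>"
proof -
  interpret K\<omega>: prob_space "K \<omega>" by (rule prob_space_K[OF \<omega>])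
  have "Pair \<omega> -` S \<inter> space Paths \<in> sets (K \<omega>)"
    using measurable_sets[OF Pair_measurable[OF \<omega>] S] by (simp add: sets_K[OF \<omega>])
  then have "measure (K \<omega>) (space (K \<omega>) - (Pair \<omega> -` S \<inter> space Paths)) = 1 - fibre_mass S \<omega>"
    unfolding fibre_mass_def by (rule K\<omega>.prob_compl)
  moreover have "Pair \<omega> -` (space Ext - S) \<inter> space Paths = space (K \<omega>) - (Pair \<omega> -` S \<inter> space Paths)"
    using \<omega> by (auto simp: space_extended_space)
  ultimately show ?thesis by (simp add: fibre_mass_def)
qed

lemma vimage_funpow_invariant:
  assumes "walker_map -` E \<inter> space Ext = E"
  shows "(walker_map ^^ n) -` E \<inter> space Ext = E"
proof (induction n)
  case 0
  then show ?case using assms by auto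
next
  case (Suc n)
  have "(walker_map ^^ Suc n) -` E \<inter> space Ext = (walker_map ^^ n) -` (walker_map -` E \<inter> space Ext) \<inter> space Ext"
    using measurable_space[OF walker_map_funpow_measurable, of _ n] by auto
  then show ?case by (simp only: assms Suc)
qed

lemma nn_integral_le_iterate:
  assumes C: "\<And>S. S \<in> sets Ext \<Longrightarrow> emeasure Ann S \<le> ennreal C * emeasure Ann ((walker_map ^^ n) -` S \<inter> space Ext)"
    and f: "f \<in> borel_measurable Ext"
  shows "(\<integral>\<^sup>+x. f x \<partial>Ann) \<le> ennreal C * (\<integral>\<^sup>+x. f ((walker_map ^^ n) x) \<partial>Ann)"
proof -
  let ?N = "distr Ann Ext (walker_map ^^ n)"
  have "Ann \<le> scale_measure (ennreal C) ?N"
    using C by (subst le_measure) (auto simp: emeasure_distr[OF walker_map_funpow_measurable_Ann])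
  then have "(\<integral>\<^sup>+x. f x \<partial>Ann) \<le> (\<integral>\<^sup>+x. f x \<partial>scale_measure (ennreal C) ?N)"
    by (intro nn_integral_mono_measure) simp_all
  also have "\<dots> = ennreal C * (\<integral>\<^sup>+x. f x \<partial>?N)"
    using f by (intro nn_integral_scale_measure) simp
  also have "(\<integral>\<^sup>+x. f x \<partial>?N) = (\<integral>\<^sup>+x. f ((walker_map ^^ n) x) \<partial>Ann)"
    by (rule nn_integral_distr[OF walker_map_funpow_measurable_Ann]) (use f in simp)
  finally show ?thesis .
qed

text \<open>Approximate \<open>E\<close> by an event \<open>D\<close> decided at a late time \<open>n\<close>. On the complement of \<open>D\<close> the
  restarted walker reaches \<open>E\<close> with small probability, and on \<open>D\<close> it fails to do so with small
  probability, so the fibre mass of \<open>E\<close> in the environment seen at time \<open>n\<close> is close to the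
  indicator of \<open>D\<close>. As \<open>E\<close> is invariant and the images of the annealed measure are uniformly
  equivalent to it, the same holds at time \<open>0\<close>.\<close>

lemma AE_fibre_mass_eq_indicator:
  assumes Pos: "cond_Pos W P p" and Exp: "cond_Exp W P p" and Abs: "cond_Abs W P p" and Ell: "cond_Ell W P p"
    and E: "E \<in> sets Ext" and inv: "walker_map -` E \<inter> space Ext = E"
  shows "AE x in Ann. fibre_mass E (fst x) = indicator E x"
proof -
  obtain C where C: "1 \<le> C" and dom: "\<And>k S. S \<in> sets Ext \<Longrightarrow>
      emeasure Ann S \<le> ennreal C * emeasure Ann ((walker_map ^^ k) -` S \<inter> space Ext)"
    using iterated_images_equivalent[OF Pos Abs] by metis
  obtain c N where c: "0 < c" and restart: "AE \<omega> in P. \<forall>m\<ge>N. \<forall>n. \<forall>u\<in>words W m. \<forall>v\<in>words W n.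
       c * (p \<omega> u * p (translate (sum_list u) \<omega>) v) \<le> p \<omega> (u @ v)"
    using AE_restart[OF Pos Exp Ell] .
  define g where "g x = ennreal \<bar>fibre_mass E (fst x) - indicator E x\<bar>" for x
  have "(\<lambda>x. fibre_mass E (fst x)) \<in> borel_measurable Ext"
    by (rule measurable_compose[OF fst_measurable_Ext fibre_mass_measurable[OF E]])
  then have g: "g \<in> borel_measurable Ext"
    unfolding g_def using borel_measurable_indicator[OF E] by measurable
  have small: "(\<integral>\<^sup>+x. g x \<partial>Ann) \<le> ennreal (C * (2 / c + 1) * e)" if e: "0 < e" for e
  proof -
    obtain D' where D': "D' \<in> finite_horizon A W" "measure Ann (sym_diff E D') < e"
      using algebra_approximation[OF algebra_finite_horizon[of A W] Ann.finite_measure_axioms _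
          Ann.finite_measure_axioms _ _ e, of E] E by (auto simp: sets_extended_space[OF finite_W])
    obtain n D where n: "N \<le> n" and D'_eq: "D' = horizon_set A W n D" and D: "\<forall>u\<in>words W n. D u \<in> sets Env"
      using finite_horizon_at_least[OF D'(1)] by blast
    let ?F = "walker_map ^^ n"
    let ?D = "horizon_set A W n D" and ?D' = "horizon_set A W n (\<lambda>u. space Env - D u)"
    let ?\<psi> = "\<lambda>S x. ennreal (fibre_mass S (fst (?F x)))"
    have Dc: "\<forall>u\<in>words W n. space Env - D u \<in> sets Env" using D by auto
    have Ec: "space Ext - E \<in> sets Ext" using E by blast
    have FE: "?F -` E \<inter> space Ext = E" by (rule vimage_funpow_invariant[OF inv])
    have FE_iff: "?F x \<in> E \<longleftrightarrow> x \<in> E" if "x \<in> space Ext" for x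
      using FE that by blast
    have FEc: "?F -` (space Ext - E) \<inter> space Ext = space Ext - E"
      using FE_iff measurable_space[OF walker_map_funpow_measurable] by blast
    have D_sets: "?D \<in> sets Ann" "?D' \<in> sets Ann"
      using sets_finite_horizon[OF finite_W horizon_setI[OF D]]
        sets_finite_horizon[OF finite_W horizon_setI[OF Dc]] by simp_all
    have D'_compl: "?D' = space Ext - ?D"
      by (auto simp: horizon_set_def space_extended_space)
    have E_sub: "E \<subseteq> space Ext" using sets.sets_into_space[OF E] .
    have symm: "sym_diff E ?D \<in> sets Ann" using D_sets(1) E by auto
    have \<epsilon>: "emeasure Ann S \<le> ennreal e" if "S \<subseteq> sym_diff E ?D" for S
    proof -
      have "emeasure Ann S \<le> emeasure Ann (sym_diff E ?D)" by (rule emeasure_mono[OF that symm])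
      also have "\<dots> \<le> ennreal e" using D'(2) by (simp add: Ann.emeasure_eq_measure D'_eq ennreal_leI)
      finally show ?thesis .
    qed
    have i1: "(\<integral>\<^sup>+x. indicator ?D' x * ?\<psi> E x \<partial>Ann) \<le> ennreal (1 / c) * ennreal e"
      using restart_inequality[OF c restart n Dc E] unfolding FE
      by (rule order_trans) (intro mult_left_mono \<epsilon>, auto simp: D'_compl)
    have i2: "(\<integral>\<^sup>+x. indicator ?D x * ?\<psi> (space Ext - E) x \<partial>Ann) \<le> ennreal (1 / c) * ennreal e"
      using restart_inequality[OF c restart n D Ec] unfolding FEc
      by (rule order_trans) (intro mult_left_mono \<epsilon>, auto)
    have \<psi>: "?\<psi> S \<in> borel_measurable Ann" if "S \<in> sets Ext" for S
    proof -
      have "(\<lambda>x. fibre_mass S (fst (?F x))) \<in> borel_measurable Ann"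
        using measurable_compose[OF measurable_compose[OF walker_map_funpow_measurable_Ann fst_measurable_Ext]
            fibre_mass_measurable[OF that]] .
      then show ?thesis by simp
    qed
    have pointwise: "g (?F x) \<le> indicator ?D' x * ?\<psi> E x + indicator ?D x * ?\<psi> (space Ext - E) x
        + indicator (sym_diff E ?D) x" if x: "x \<in> space Ann" for x
    proof -
      have \<omega>: "fst (?F x) \<in> space Env"
        using measurable_space[OF measurable_compose[OF walker_map_funpow_measurable_Ann fst_measurable_Ext] x] .
      define f where "f = fibre_mass E (fst (?F x))"
      have f: "0 \<le> f" "f \<le> 1" using fibre_mass_bounds[OF \<omega>] by (simp_all add: f_def)
      have "g (?F x) = ennreal \<bar>f - indicator E x\<bar>"
        using FE_iff[of x] x by (simp add: g_def f_def indicator_def)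
      also have "\<bar>f - indicator E x\<bar> \<le>
          indicator ?D' x * f + indicator ?D x * (1 - f) + indicator (sym_diff E ?D) x"
      proof -
        have "x \<in> ?D' \<longleftrightarrow> x \<notin> ?D" using x by (simp add: D'_compl)
        then show ?thesis using f by (cases "x \<in> E"; cases "x \<in> ?D") simp_all
      qed
      then have "ennreal \<bar>f - indicator E x\<bar> \<le>
          ennreal (indicator ?D' x * f + indicator ?D x * (1 - f) + indicator (sym_diff E ?D) x)"
        by (rule ennreal_leI)
      also have "\<dots> = indicator ?D' x * ennreal f + indicator ?D x * ennreal (1 - f)
          + indicator (sym_diff E ?D) x"
        using f by (simp add: ennreal_mult ennreal_indicator)
      finally show ?thesis by (simp only: fibre_mass_compl[OF \<omega> E] f_def)
    qed
    have m1: "(\<lambda>x. indicator ?D' x * ?\<psi> E x) \<in> borel_measurable Ann"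
      by (rule borel_measurable_times_ennreal[OF borel_measurable_indicator[OF D_sets(2)] \<psi>[OF E]])
    have m2: "(\<lambda>x. indicator ?D x * ?\<psi> (space Ext - E) x) \<in> borel_measurable Ann"
      by (rule borel_measurable_times_ennreal[OF borel_measurable_indicator[OF D_sets(1)] \<psi>[OF Ec]])
    have m3: "(indicator (sym_diff E ?D) :: _ \<Rightarrow> ennreal) \<in> borel_measurable Ann"
      by (rule borel_measurable_indicator[OF symm])
    have "(\<integral>\<^sup>+x. g (?F x) \<partial>Ann) \<le> (\<integral>\<^sup>+x. indicator ?D' x * ?\<psi> E x + indicator ?D x * ?\<psi> (space Ext - E) x
        + indicator (sym_diff E ?D) x \<partial>Ann)"
      by (intro nn_integral_mono pointwise)
    also have "\<dots> = (\<integral>\<^sup>+x. indicator ?D' x * ?\<psi> E x \<partial>Ann) + (\<integral>\<^sup>+x. indicator ?D x * ?\<psi> (space Ext - E) x \<partial>Ann)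
        + (\<integral>\<^sup>+x. indicator (sym_diff E ?D) x \<partial>Ann)"
      by (subst nn_integral_add[OF borel_measurable_add[OF m1 m2] m3], subst nn_integral_add[OF m1 m2])
        (rule refl)
    also have "\<dots> \<le> ennreal (1 / c) * ennreal e + ennreal (1 / c) * ennreal e + ennreal e"
      using i1 i2 \<epsilon>[OF order_refl] symm by (intro add_mono) simp_all
    also have "\<dots> = ennreal ((2 / c + 1) * e)"
      using c e by (simp add: ennreal_mult[symmetric] ennreal_plus[symmetric] distrib_right del: ennreal_plus)
    finally have "ennreal C * (\<integral>\<^sup>+x. g (?F x) \<partial>Ann) \<le> ennreal C * ennreal ((2 / c + 1) * e)"
      by (intro mult_left_mono) auto
    also have "\<dots> = ennreal (C * (2 / c + 1) * e)"
      using C c e by (simp add: ennreal_mult[symmetric] mult.assoc)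
    finally have "ennreal C * (\<integral>\<^sup>+x. g (?F x) \<partial>Ann) \<le> ennreal (C * (2 / c + 1) * e)" .
    with nn_integral_le_iterate[OF dom g, of n] show ?thesis by (rule order_trans)
  qed
  have "(\<integral>\<^sup>+x. g x \<partial>Ann) \<le> 0"
  proof (rule ennreal_le_epsilon)
    fix e :: real assume e: "0 < e"
    define k where "k = C * (2 / c + 1)"
    have "0 < k" using C c by (simp add: k_def add_pos_pos)
    then show "(\<integral>\<^sup>+x. g x \<partial>Ann) \<le> 0 + ennreal e"
      using small[of "e / k", folded k_def] e by simp
  qed
  then have "(\<integral>\<^sup>+x. g x \<partial>Ann) = 0" by simp
  moreover have "g \<in> borel_measurable Ann" using g by (simp only: measurable_cong_sets[OF sets_Ann refl])
  ultimately have "AE x in Ann. g x = 0" by (simp add: nn_integral_0_iff_AE)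
  then show ?thesis by eventually_elim (simp add: g_def)
qed

text \<open>A letter has positive quenched probability, so a property of the environment that holds whenever
  the walker starts with this letter holds almost surely.\<close>

lemma AE_P_of_AE_letter:
  assumes Pos: "cond_Pos W P p" and a: "a \<in> W"
    and Q: "{\<omega> \<in> space Env. \<not> Q \<omega>} \<in> sets Env"
    and AE: "AE x in Ann. snd x 0 = a \<longrightarrow> Q (fst x)"
  shows "AE \<omega> in P. Q \<omega>"
proof -
  let ?B = "{\<omega> \<in> space Env. \<not> Q \<omega>}"
  have a': "[a] \<in> words W 1" using a by (simp add: words_def)
  have "AE x in Ann. x \<notin> ?B \<times> cylinder W [a]"
    using AE
  proof eventually_elim
    case (elim x)
    have "snd x 0 = a" if "snd x \<in> cylinder W [a]"
      using that in_cylinder[OF a'] by (simp add: segment_def)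
    with elim show ?case by (auto simp: mem_Times_iff)
  qed
  moreover have rect: "?B \<times> cylinder W [a] \<in> sets Ann"
    using rectangle_sets[OF finite_W a' Q] by simp
  ultimately have "?B \<times> cylinder W [a] \<in> null_sets Ann"
    by (simp only: AE_iff_null_sets)
  then have "emeasure Ann (?B \<times> cylinder W [a]) = 0" by (rule null_setsD1)
  then have "(\<integral>\<^sup>+\<omega>. ennreal (p \<omega> [a]) * indicator ?B \<omega> \<partial>P) = 0"
    by (simp only: emeasure_Ann_rectangle[OF a' Q])
  moreover have "(\<lambda>\<omega>. ennreal (p \<omega> [a]) * indicator ?B \<omega>) \<in> borel_measurable P"
  proof -
    have "(\<lambda>\<omega>. ennreal (p \<omega> [a]) * indicator ?B \<omega>) \<in> borel_measurable Env"
      using p_measurable[OF a'] by (intro borel_measurable_times_ennreal borel_measurable_indicator[OF Q]) simp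
    then show ?thesis by (simp only: measurable_cong_sets[OF sets_P refl])
  qed
  ultimately have "AE \<omega> in P. ennreal (p \<omega> [a]) * indicator ?B \<omega> = 0"
    by (simp only: nn_integral_0_iff_AE)
  then show ?thesis
    using AE_positive_words[OF Pos] AE_P_space
  proof eventually_elim
    case (elim \<omega>)
    have "0 < p \<omega> [a]" using elim(2) a' by blast
    with elim(1,3) show ?case by (auto simp: indicator_def split: if_splits)
  qed
qed

text \<open>By the preceding lemmas the fibre mass of an invariant event is \<open>0\<close> or \<open>1\<close> and does not
  change along the steps of the walker, all of which have positive probability. It is thus invariant
  under the group in the condition (Pro).\<close>

lemma invariant_event_trivial:
  assumes Pos: "cond_Pos W P p" and Exp: "cond_Exp W P p" and Abs: "cond_Abs W P p" and Ell: "cond_Ell W P p"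
    and Pro: "cond_Pro W P" and E: "E \<in> sets Ext" and inv: "walker_map -` E \<inter> space Ext = E"
  shows "measure Ann E = 0 \<or> measure Ann E = 1"
proof -
  let ?\<phi> = "fibre_mass E"
  have \<phi>: "?\<phi> \<in> borel_measurable Env" by (rule fibre_mass_measurable[OF E])
  have fibre: "AE x in Ann. ?\<phi> (fst x) = indicator E x"
    by (rule AE_fibre_mass_eq_indicator[OF Pos Exp Abs Ell E inv])
  obtain C where upper: "\<And>k S. S \<in> sets Ext \<Longrightarrow>
      emeasure Ann ((walker_map ^^ k) -` S \<inter> space Ext) \<le> ennreal C * emeasure Ann S"
    using iterated_images_equivalent[OF Pos Abs] by metis
  have next_fibre: "AE x in Ann. ?\<phi> (fst (walker_map x)) = indicator E (walker_map x)"
  proof -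
    let ?Z = "{x \<in> space Ext. ?\<phi> (fst x) \<noteq> indicator E x}"
    have "(\<lambda>x. ?\<phi> (fst x)) \<in> borel_measurable Ext"
      by (rule measurable_compose[OF fst_measurable_Ext \<phi>])
    then have Z: "?Z \<in> sets Ext" using borel_measurable_indicator[OF E] by measurable
    have "AE x in Ann. x \<notin> ?Z" using fibre by eventually_elim simp
    then have "?Z \<in> null_sets Ann" using Z by (simp only: AE_iff_null_sets sets_Ann)
    then have "emeasure Ann ?Z = 0" by (rule null_setsD1)
    then have "emeasure Ann (walker_map -` ?Z \<inter> space Ext) = 0" using upper[OF Z, of 1] by simp
    then have "walker_map -` ?Z \<inter> space Ext \<in> null_sets Ann"
      using measurable_sets[OF walker_map_measurable Z] by (simp add: null_sets_def)
    then have "AE x in Ann. x \<notin> walker_map -` ?Z \<inter> space Ext" by (rule AE_not_in)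
    then show ?thesis
      using AE_space
    proof eventually_elim
      case (elim x)
      then show ?case using measurable_space[OF walker_map_measurable, of x] by auto
    qed
  qed
  have step: "AE \<omega> in P. ?\<phi> (translate a \<omega>) = ?\<phi> \<omega>" if a: "a \<in> W" for a
  proof (rule AE_P_of_AE_letter[OF Pos a])
    have "(\<lambda>\<omega>. ?\<phi> (translate a \<omega>)) \<in> borel_measurable Env"
      by (rule measurable_compose[OF translate_measurable \<phi>])
    then show "{\<omega> \<in> space Env. ?\<phi> (translate a \<omega>) \<noteq> ?\<phi> \<omega>} \<in> sets Env"
      by (rule borel_measurable_neq[OF _ \<phi>])
    show "AE x in Ann. snd x 0 = a \<longrightarrow> ?\<phi> (translate a (fst x)) = ?\<phi> (fst x)"
      using fibre next_fibre AE_space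
    proof eventually_elim
      case (elim x)
      have "walker_map x \<in> E \<longleftrightarrow> x \<in> E" using inv elim(3) by auto
      then show ?case using elim(1,2) by (auto simp: walker_map_eq indicator_def)
    qed
  qed
  have zero_one: "AE \<omega> in P. ?\<phi> \<omega> = 0 \<or> ?\<phi> \<omega> = 1"
  proof -
    obtain a where a: "a \<in> W" using W_nonempty by blast
    show ?thesis
    proof (rule AE_P_of_AE_letter[OF Pos a])
      show "{\<omega> \<in> space Env. \<not> (?\<phi> \<omega> = 0 \<or> ?\<phi> \<omega> = 1)} \<in> sets Env" using \<phi> by measurable
      show "AE x in Ann. snd x 0 = a \<longrightarrow> ?\<phi> (fst x) = 0 \<or> ?\<phi> (fst x) = 1"
        using fibre by eventually_elim (simp add: indicator_def)
    qed
  qed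
  have "AE \<omega> in P. \<forall>a\<in>W. ?\<phi> (translate a \<omega>) = ?\<phi> \<omega>"
    using step by (simp add: AE_ball_countable countable_finite[OF finite_W])
  from AE_translates[OF this]
  have reach: "AE \<omega> in P. \<forall>z\<in>reachable W. ?\<phi> (translate z \<omega>) = ?\<phi> \<omega>"
  proof eventually_elim
    case (elim \<omega>)
    have "?\<phi> (translate (sum_list u) \<omega>) = ?\<phi> \<omega>" if "set u \<subseteq> W" for u
      using that
    proof (induction u)
      case (Cons a u)
      then have "?\<phi> (translate a (translate (sum_list u) \<omega>)) = ?\<phi> (translate (sum_list u) \<omega>)"
        using elim by simp
      with Cons show ?case by (simp add: translate_add)
    qed simp
    then show ?case by (auto simp: reachable_def words_def)
  qed
  \<comment> \<open>The event \<open>\<phi> = 1\<close> is invariant under the group up to null sets; \<open>B\<close> is an exactly invariant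
    version of it.\<close>
  define B where "B = {\<omega> \<in> space Env. \<forall>z\<in>reachable W. ?\<phi> (translate z \<omega>) = 1}"
  have "{\<omega> \<in> space Env. ?\<phi> (translate z \<omega>) = 1} \<in> sets Env" for z
    using measurable_compose[OF translate_measurable \<phi>] by measurable
  then have B: "B \<in> sets Env"
    unfolding B_def by (intro sets.sets_Collect_countable_Ball) auto
  have Pro': "0 \<in> reachable W" "\<forall>x\<in>reachable W. \<forall>y\<in>reachable W. x + y \<in> reachable W"
    "\<forall>x\<in>reachable W. - x \<in> reachable W" "ergodic P (translate ` reachable W)"
    using Pro by (auto simp: cond_Pro_def)
  have "translate y -` B \<inter> space P = B" if y: "y \<in> reachable W" for y
  proof (intro set_eqI iffI)
    fix \<omega> assume "\<omega> \<in> translate y -` B \<inter> space P"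
    then have \<omega>: "\<omega> \<in> space Env" and *: "\<forall>z\<in>reachable W. ?\<phi> (translate (z + y) \<omega>) = 1"
      by (auto simp: B_def space_P translate_add)
    have "?\<phi> (translate z \<omega>) = 1" if "z \<in> reachable W" for z
    proof -
      have "z + - y \<in> reachable W" using that y Pro'(2,3) by blast
      from bspec[OF * this] show ?thesis by simp
    qed
    with \<omega> show "\<omega> \<in> B" by (simp add: B_def)
  next
    fix \<omega> assume "\<omega> \<in> B"
    then show "\<omega> \<in> translate y -` B \<inter> space P"
      using y Pro'(2) by (auto simp: B_def space_P translate_add translate_in_space)
  qed
  then have "measure P B = 0 \<or> measure P B = 1"
    using Pro'(4) B by (auto simp: ergodic_def sets_P)
  moreover have Ann_E: "emeasure Ann E = (\<integral>\<^sup>+\<omega>. ennreal (?\<phi> \<omega>) \<partial>P)"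
    unfolding Ann_eq_joint by (rule emeasure_joint[OF sets_P E])
  moreover have "measure Ann E = 0" if "measure P B = 0"
  proof -
    have "AE \<omega> in P. \<omega> \<notin> B" using that B P.prob_eq_0[of B] by (simp add: sets_P)
    then have "AE \<omega> in P. ennreal (?\<phi> \<omega>) = 0"
      using zero_one reach AE_P_space by eventually_elim (auto simp: B_def)
    then have "(\<integral>\<^sup>+\<omega>. ennreal (?\<phi> \<omega>) \<partial>P) = (\<integral>\<^sup>+\<omega>. 0 \<partial>P)" by (rule nn_integral_cong_AE)
    then show ?thesis using Ann_E by (simp add: measure_def)
  qed
  moreover have "measure Ann E = 1" if "measure P B = 1"
  proof -
    have "AE \<omega> in P. \<omega> \<in> B" using that B P.prob_eq_1[of B] by (simp add: sets_P)
    then have "AE \<omega> in P. ennreal (?\<phi> \<omega>) = 1"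
      using reach by eventually_elim (use Pro'(1) in \<open>force simp: B_def\<close>)
    then have "(\<integral>\<^sup>+\<omega>. ennreal (?\<phi> \<omega>) \<partial>P) = (\<integral>\<^sup>+\<omega>. 1 \<partial>P)" by (rule nn_integral_cong_AE)
    then show ?thesis using Ann_E by (simp add: measure_def P.emeasure_space_1)
  qed
  ultimately show ?thesis by blast
qed

end

section \<open>Uniqueness and the law of large numbers\<close>

context random_walk
begin

text \<open>The events that are trivial for one measure are trivial for any equivalent one.\<close>

lemma ergodic_of_equivalent:
  assumes Pos: "cond_Pos W P p" and Exp: "cond_Exp W P p" and Abs: "cond_Abs W P p" and Ell: "cond_Ell W P p"
    and Pro: "cond_Pro W P" and Q: "invariant_equivalent_measure A W P p Q"
  shows "ergodic Q {walker_map}"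
proof -
  interpret Q: prob_space Q using Q by (simp add: invariant_equivalent_measure_def)
  have sets_Q: "sets Q = sets Ext" and inv: "invariant_under Q walker_map"
    and null: "absolutely_continuous Ann Q"
    using Q by (auto simp: invariant_equivalent_measure_def equivalent_measures_def)
  have space_Q: "space Q = space Ext" using sets_Q by (rule sets_eq_imp_space_eq)
  have zero: "measure Q E = 0" if "E \<in> sets Ext" "measure Ann E = 0" for E
  proof -
    have "E \<in> null_sets Ann" using that by (simp add: null_sets_def Ann.emeasure_eq_measure)
    then have "E \<in> null_sets Q" using null unfolding absolutely_continuous_def by blast
    then show ?thesis by (simp add: measure_def null_setsD1)
  qed
  have "measure Q E = 0 \<or> measure Q E = 1"
    if E: "E \<in> sets Q" and "walker_map -` E \<inter> space Q = E" for E
  proof -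
    have E': "E \<in> sets Ext" using E by (simp add: sets_Q)
    have "measure Ann E = 0 \<or> measure Ann E = 1"
      using that by (intro invariant_event_trivial[OF Pos Exp Abs Ell Pro E']) (simp add: space_Q)
    then show ?thesis
    proof
      assume "measure Ann E = 1"
      then have "measure Ann (space Ext - E) = 0" using Ann.prob_compl[of E] E' by simp
      then have "measure Q (space Q - E) = 0" using zero[of "space Ext - E"] E' by (simp add: space_Q)
      then show ?thesis using Q.prob_compl[OF E] by simp
    qed (use zero[OF E'] in blast)
  qed
  with inv show ?thesis by (auto simp: ergodic_def)
qed

lemma AE_Ann_of_AE_equivalent:
  assumes Q: "invariant_equivalent_measure A W P p Q" and "AE x in Q. R x"
  shows "AE x in Ann. R x"
proof (rule absolutely_continuous_AE[OF _ _ assms(2)])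
  show "sets Ann = sets Q" and "absolutely_continuous Q Ann"
    using Q by (simp_all add: invariant_equivalent_measure_def equivalent_measures_def)
qed

text \<open>For an event \<open>S\<close> the frequency of visits to \<open>S\<close> tends to \<open>Q S\<close>, almost surely with respect to
  the annealed measure, so the latter determines \<open>Q S\<close>.\<close>

lemma equivalent_invariant_measure_unique:
  assumes Pos: "cond_Pos W P p" and Exp: "cond_Exp W P p" and Abs: "cond_Abs W P p" and Ell: "cond_Ell W P p"
    and Pro: "cond_Pro W P" and Q: "invariant_equivalent_measure A W P p Q"
    and Q': "invariant_equivalent_measure A W P p Q'"
  shows "Q' = Q"
proof (rule measure_eqI)
  have sets_Q: "sets Q = sets Ext" "sets Q' = sets Ext" and prob: "prob_space Q" "prob_space Q'"
    using Q Q' by (auto simp: invariant_equivalent_measure_def)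
  show "sets Q' = sets Q" by (simp add: sets_Q)
  fix S assume "S \<in> sets Q'"
  then have S: "S \<in> sets Ext" by (simp add: sets_Q)
  have visits: "AE x in Ann. (\<lambda>n. orbit_sum walker_map (indicator S) n x / real n) \<longlonglongrightarrow> measure R S"
    if R: "invariant_equivalent_measure A W P p R" for R
  proof (rule AE_Ann_of_AE_equivalent[OF R])
    have sets_R: "S \<in> sets R" and prob_R: "prob_space R"
      using R S by (auto simp: invariant_equivalent_measure_def)
    have "AE x in R. (\<lambda>n. orbit_sum walker_map (indicator S) n x / real n) \<longlonglongrightarrow> (\<integral>x. indicator S x \<partial>R)"
      by (rule prob_space.birkhoff_bounded[OF prob_R ergodic_of_equivalent[OF Pos Exp Abs Ell Pro R], where c=1])
        (use sets_R in \<open>auto simp: indicator_def\<close>)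
    moreover have "(\<integral>x. indicator S x \<partial>R) = measure R S"
      using sets.sets_into_space[OF sets_R] by (simp add: Int_absorb1 Int_absorb2)
    ultimately show "AE x in R. (\<lambda>n. orbit_sum walker_map (indicator S) n x / real n) \<longlonglongrightarrow> measure R S"
      by simp
  qed
  have "AE x in Ann. measure Q' S = measure Q S"
    using visits[OF Q] visits[OF Q'] by eventually_elim (rule LIMSEQ_unique)
  then have "measure Q' S = measure Q S" by simp
  then show "emeasure Q' S = emeasure Q S"
    using prob by (simp add: finite_measure.emeasure_eq_measure prob_space.finite_measure)
qed

lemma law_of_large_numbers:
  assumes Pos: "cond_Pos W P p" and Exp: "cond_Exp W P p" and Abs: "cond_Abs W P p" and Ell: "cond_Ell W P p"
    and Pro: "cond_Pro W P" and Q: "invariant_equivalent_measure A W P p Q"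
  shows "AE (\<omega>, w) in Ann. (\<lambda>n. real_vec (position w n) /\<^sub>R real n) \<longlonglongrightarrow> (\<integral>(\<omega>', w'). real_vec (w' 0) \<partial>Q)"
proof -
  interpret Q: prob_space Q using Q by (simp add: invariant_equivalent_measure_def)
  have sets_Q: "sets Q = sets Ext" using Q by (simp add: invariant_equivalent_measure_def)
  have space_Q: "space Q = space Ext" using sets_Q by (rule sets_eq_imp_space_eq)
  let ?v = "\<lambda>x :: ((int ^ 'd) \<Rightarrow> 'a) \<times> (nat \<Rightarrow> int ^ 'd). real_vec (snd x 0)"
  have "(\<lambda>x. snd x 0) \<in> measurable Ext (count_space W)"
    by (rule measurable_compose[OF snd_measurable_Ext coordinate_measurable])
  then have "?v \<in> borel_measurable Ext" by (rule measurable_compose) simp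
  then have v: "?v \<in> borel_measurable Q" by (simp only: measurable_cong_sets[OF sets_Q refl])
  define b where "b = (\<Sum>a\<in>W. norm (real_vec a))"
  have bound: "norm (?v x) \<le> b" if "x \<in> space Q" for x
  proof -
    have "snd x 0 \<in> W"
      using that by (simp add: space_Q space_extended_space mem_Times_iff in_space_path_space)
    then show ?thesis unfolding b_def using finite_W by (intro member_le_sum) auto
  qed
  have int: "integrable Q ?v"
    by (rule Q.integrable_const_bound[where B=b]) (use bound v in auto)
  have component: "AE x in Q. (\<lambda>n. orbit_sum walker_map (\<lambda>x. ?v x $ i) n x / real n) \<longlonglongrightarrow> (\<integral>x. ?v x \<partial>Q) $ i" for i
  proof -
    have "AE x in Q. (\<lambda>n. orbit_sum walker_map (\<lambda>x. ?v x $ i) n x / real n) \<longlonglongrightarrow> (\<integral>x. ?v x $ i \<partial>Q)"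
    proof (rule Q.birkhoff_bounded[OF ergodic_of_equivalent[OF Pos Exp Abs Ell Pro Q]])
      show "(\<lambda>x. ?v x $ i) \<in> borel_measurable Q"
        by (rule measurable_compose[OF v]) (rule borel_measurable_continuous_onI, intro continuous_intros)
      show "\<bar>?v x $ i\<bar> \<le> b" if "x \<in> space Q" for x
        using component_le_norm_cart[of "?v x" i] bound[OF that] by linarith
    qed
    moreover have "(\<integral>x. ?v x $ i \<partial>Q) = (\<integral>x. ?v x \<partial>Q) $ i"
      by (rule integral_bounded_linear[OF bounded_linear_vec_nth int])
    ultimately show ?thesis by simp
  qed
  have orbit: "orbit_sum walker_map (\<lambda>x. ?v x $ i) n x / real n = (real_vec (position (snd x) n) /\<^sub>R real n) $ i" for i n x
    by (simp add: orbit_sum_def walker_map_funpow real_vec_def position_def divide_inverse mult.commute)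
  have "AE x in Q. \<forall>i. (\<lambda>n. (real_vec (position (snd x) n) /\<^sub>R real n) $ i) \<longlonglongrightarrow> (\<integral>x. ?v x \<partial>Q) $ i"
    using component unfolding orbit by (rule eventually_all_finite)
  then have "AE x in Q. (\<lambda>n. real_vec (position (snd x) n) /\<^sub>R real n) \<longlonglongrightarrow> (\<integral>x. ?v x \<partial>Q)"
    by eventually_elim (rule vec_tendstoI, blast)
  then show ?thesis
    unfolding split_beta' by (rule AE_Ann_of_AE_equivalent[OF Q])
qed

end

theorem theorem4p9:
  fixes A :: "'a measure"
    and W :: "(int ^ 'd) set"
    and P :: "((int ^ 'd) \<Rightarrow> 'a) measure"
    and p :: "((int ^ 'd) \<Rightarrow> 'a) \<Rightarrow> (int ^ 'd) list \<Rightarrow> real"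
  assumes "finite W" and "card W \<ge> 2"
    and "prob_space P" and "sets P = sets (environment_space A)"
    and "\<forall>z. invariant_under P (translate z)" and "ergodic P (range translate)"
    and "path_probabilities A W p"
    and "cond_Pos W P p" and "cond_Exp W P p" and "cond_Abs W P p"
    and "cond_Ell W P p" and "cond_Pro W P"
  shows "\<exists>Q. invariant_equivalent_measure A W P p Q \<and>
    (\<forall>Q'. invariant_equivalent_measure A W P p Q' \<longrightarrow> Q' = Q) \<and>
    ergodic Q {walker_map} \<and>
    (AE (\<omega>, w) in annealed_measure A W P p.
       (\<lambda>n. real_vec (position w n) /\<^sub>R real n) \<longlonglongrightarrow> (\<integral>(\<omega>', w'). real_vec (w' 0) \<partial>Q))"
proof -
  interpret random_walk A W P p
    using assms(1-5,7) by (intro random_walk.intro) auto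
  note conds = assms(8-12)
  obtain C where C: "1 \<le> C"
    and below: "\<And>k S. S \<in> sets Ext \<Longrightarrow> emeasure Ann S \<le> ennreal C * emeasure Ann ((walker_map ^^ k) -` S \<inter> space Ext)"
    and above: "\<And>k S. S \<in> sets Ext \<Longrightarrow> emeasure Ann ((walker_map ^^ k) -` S \<inter> space Ext) \<le> ennreal C * emeasure Ann S"
    using iterated_images_equivalent[OF conds(1,3)] by metis
  have "\<exists>Q. prob_space Q \<and> sets Q = sets Ann \<and> invariant_under Q walker_map \<and> equivalent_measures Q Ann"
  proof (rule Ann.ex_equivalent_invariant_measure)
    show "walker_map \<in> measurable Ann Ann"
      using walker_map_measurable by (simp only: measurable_cong_sets[OF sets_Ann sets_Ann])
    show "0 < 1 / C" using C by simp
    fix k S assume S: "S \<in> sets Ann"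
    then have S': "S \<in> sets Ext" by simp
    show "1 / C * measure Ann S \<le> measure Ann ((walker_map ^^ k) -` S \<inter> space Ann)"
      using below[OF S', of k] C
      by (simp add: Ann.emeasure_eq_measure ennreal_mult[symmetric] field_simps)
    show "measure Ann ((walker_map ^^ k) -` S \<inter> space Ann) \<le> C * measure Ann S"
      using above[OF S', of k] C by (simp add: Ann.emeasure_eq_measure ennreal_mult[symmetric])
  qed
  then obtain Q where Q: "invariant_equivalent_measure A W P p Q"
    by (auto simp: invariant_equivalent_measure_def)
  show ?thesis
    using Q equivalent_invariant_measure_unique[OF conds Q] ergodic_of_equivalent[OF conds Q]
      law_of_large_numbers[OF conds Q] by blast
qed


end
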